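(* Let $n\ge 4$ and let $\boldsymbol h=(h_1,\ldots,h_n)$ be a homogeneous reduced self-vanishing system in $K[x]=K[x_1,\ldots,x_n]$. Let $Z:\mathbb P^{n-1}\dashrightarrow\mathbb P^{n-1}$ be the rational map $(x_1:\cdots:x_n)\mapsto(h_1(x):\cdots:h_n(x))$, let $W$ be its image, and let $T=\{h_1=\cdots=h_n=0\}\subset\mathbb P^{n-1}$ be its fundamental locus. If $\dim W\ge 1$, then $$2\le\operatorname{Krull\,dim}K[x]/(h_1,\ldots,h_n)\le n-2,$$ or equivalently $$1\le\dim T\le n-3.$$
   Context: $K$ is an algebraically closed field of characteristic zero. A homogeneous self-vanishing system is a nonzero vector $\boldsymbol h=(h_1,\ldots,h_n)$ of homogeneous polynomials $h_i\in K[x_1,\ldots,x_n]$ of the same degree such that $\sum_{k=1}^n h_k\frac{\partial h_j}{\partial x_k}=0$ for all $j$. It is reduced if $\mathrm{GCD}(h_1,\ldots,h_n)=1$. The image $W$ is taken as a closed algebraic set: it is the subset of $\mathbb P^{n-1}$ defined by the (homogeneous) kernel of the homomorphism $K[y_1,\ldots,y_n]\to K[x_1,\ldots,x_n]$, $y_j\mapsto h_j$. *)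

theory Defs
  imports
    "HOL-Library.Poly_Mapping"
    "HOL-Library.Cardinality"
    "HOL-Library.Extended_Real"
    "HOL-Algebra.QuotRing"
    "HOL-Algebra.Algebraic_Closure_Type"
begin

section \<open>Polynomials in finitely many variables\<close>

text \<open>
  The variables are indexed by a finite type \<open>'n\<close> with \<open>n = CARD('n)\<close>.
  A monomial is its exponent vector, so the multiplication that \<open>Poly_Mapping\<close> provides
  (convolution over the additive monoid of exponent vectors) is polynomial multiplication.
\<close>

type_synonym ('n, 'k) mpoly = "('n \<Rightarrow>\<^sub>0 nat) \<Rightarrow>\<^sub>0 'k"

definition eval_hom ::
    "('k::zero \<Rightarrow> 'r::comm_semiring_1) \<Rightarrow> ('n::finite \<Rightarrow> 'r) \<Rightarrow> ('n, 'k) mpoly \<Rightarrow> 'r" where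
  "eval_hom \<phi> a f =
     (\<Sum>m\<in>Poly_Mapping.keys f.
        \<phi> (Poly_Mapping.lookup f m) * (\<Prod>i\<in>UNIV. a i ^ Poly_Mapping.lookup m i))"

definition mpoly_eval :: "('n::finite \<Rightarrow> 'k::comm_semiring_1) \<Rightarrow> ('n, 'k) mpoly \<Rightarrow> 'k" where
  "mpoly_eval = eval_hom (\<lambda>c. c)"

text \<open>The \<open>'k\<close>-algebra homomorphism sending the variable \<open>y\<^sub>j\<close> to \<open>h j\<close>.\<close>

definition mpoly_subst ::
    "('n::finite \<Rightarrow> ('n, 'k::comm_semiring_1) mpoly) \<Rightarrow> ('n, 'k) mpoly \<Rightarrow> ('n, 'k) mpoly" where
  "mpoly_subst = eval_hom (Poly_Mapping.single 0)"

text \<open>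
  The subtraction of exponent vectors is truncated, but whenever it truncates, the
  coefficient \<open>of_nat (lookup m k)\<close> is zero.
\<close>

definition partial_deriv :: "'n \<Rightarrow> ('n, 'k::comm_semiring_1) mpoly \<Rightarrow> ('n, 'k) mpoly" where
  "partial_deriv k f =
     (\<Sum>m\<in>Poly_Mapping.keys f.
        Poly_Mapping.single (m - Poly_Mapping.single k 1)
          (of_nat (Poly_Mapping.lookup m k) * Poly_Mapping.lookup f m))"

definition homogeneous :: "nat \<Rightarrow> ('n::finite, 'k::zero) mpoly \<Rightarrow> bool" where
  "homogeneous d f \<longleftrightarrow> (\<forall>m\<in>Poly_Mapping.keys f. (\<Sum>i\<in>UNIV. Poly_Mapping.lookup m i) = d)"

section \<open>Self-vanishing systems\<close>

definition homogeneous_self_vanishing_system ::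
    "('n::finite \<Rightarrow> ('n, 'k::comm_semiring_1) mpoly) \<Rightarrow> bool" where
  "homogeneous_self_vanishing_system h \<longleftrightarrow>
     (\<exists>i. h i \<noteq> 0) \<and>
     (\<exists>d. \<forall>i. homogeneous d (h i)) \<and>
     (\<forall>j. (\<Sum>k\<in>UNIV. h k * partial_deriv k (h j)) = 0)"

definition is_GCD :: "'r::comm_semiring_1 \<Rightarrow> 'r set \<Rightarrow> bool" where
  "is_GCD d A \<longleftrightarrow> (\<forall>a\<in>A. d dvd a) \<and> (\<forall>g. (\<forall>a\<in>A. g dvd a) \<longrightarrow> g dvd d)"

definition reduced_system :: "('n \<Rightarrow> ('n, 'k::comm_semiring_1) mpoly) \<Rightarrow> bool" where
  "reduced_system h \<longleftrightarrow> is_GCD 1 (h ` UNIV)"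

section \<open>Krull dimension\<close>

text \<open>
  Dimensions are suprema in the extended reals, so the dimension of the zero ring and of the
  empty set is \<open>-\<infinity>\<close>.
\<close>

definition krull_dim :: "('a, 'b) ring_scheme \<Rightarrow> ereal" where
  "krull_dim R =
     Sup {ereal (real d) | d. \<exists>Ps. length Ps = Suc d \<and> sorted_wrt (\<subset>) Ps \<and>
                                   (\<forall>P\<in>set Ps. primeideal P R)}"

text \<open>The ring \<open>K[x]/(h\<^sub>1, \<dots>, h\<^sub>n)\<close>.\<close>

definition system_quotient ::
    "('n \<Rightarrow> ('n, 'k::comm_ring_1) mpoly) \<Rightarrow> ('n, 'k) mpoly set ring" where
  "system_quotient h =
     ring_of_type_algebra Quot (Idl\<^bsub>ring_of_type_algebra\<^esub> (h ` UNIV))"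

section \<open>Closed subsets of projective space\<close>

text \<open>
  Points of \<open>\<P>\<^sup>n\<^sup>-\<^sup>1\<close> are the classes of nonzero coordinate vectors modulo nonzero scalars.
\<close>

definition proj_rel :: "(('n \<Rightarrow> 'k::field) \<times> ('n \<Rightarrow> 'k)) set" where
  "proj_rel = {(u, v). u \<noteq> (\<lambda>_. 0) \<and> v \<noteq> (\<lambda>_. 0) \<and>
                       (\<exists>c. c \<noteq> 0 \<and> v = (\<lambda>i. c * u i))}"

lemma equiv_proj_rel: "equiv {v :: 'n \<Rightarrow> 'k::field. v \<noteq> (\<lambda>_. 0)} proj_rel"
proof (rule equivI)
  show "proj_rel \<subseteq> {v :: 'n \<Rightarrow> 'k. v \<noteq> (\<lambda>_. 0)} \<times> {v. v \<noteq> (\<lambda>_. 0)}"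
    by (auto simp: proj_rel_def)
  show "refl_on {v :: 'n \<Rightarrow> 'k. v \<noteq> (\<lambda>_. 0)} proj_rel"
    by (auto simp: refl_on_def proj_rel_def intro: exI[of _ 1])
  show "sym (proj_rel :: (('n \<Rightarrow> 'k) \<times> ('n \<Rightarrow> 'k)) set)"
  proof (rule symI)
    fix u v :: "'n \<Rightarrow> 'k"
    assume "(u, v) \<in> proj_rel"
    then obtain c where "c \<noteq> 0" "u \<noteq> (\<lambda>_. 0)" "v \<noteq> (\<lambda>_. 0)" "v = (\<lambda>i. c * u i)"
      by (auto simp: proj_rel_def)
    then show "(v, u) \<in> proj_rel"
      by (auto simp: proj_rel_def field_simps intro!: exI[of _ "inverse c"])
  qed
  show "trans (proj_rel :: (('n \<Rightarrow> 'k) \<times> ('n \<Rightarrow> 'k)) set)"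
  proof (rule transI)
    fix u v w :: "'n \<Rightarrow> 'k"
    assume "(u, v) \<in> proj_rel" "(v, w) \<in> proj_rel"
    then obtain c d where "c \<noteq> 0" "d \<noteq> 0" "u \<noteq> (\<lambda>_. 0)" "w \<noteq> (\<lambda>_. 0)"
        "v = (\<lambda>i. c * u i)" "w = (\<lambda>i. d * v i)"
      by (auto simp: proj_rel_def)
    then show "(u, w) \<in> proj_rel"
      by (auto simp: proj_rel_def mult.assoc intro!: exI[of _ "d * c"])
  qed
qed

definition proj_space :: "('n \<Rightarrow> 'k::field) set set" where
  "proj_space = {v. v \<noteq> (\<lambda>_. 0)} // proj_rel"

text \<open>
  As usual, the zero set of an arbitrary set of polynomials (in particular of a homogeneous
  ideal) is the common zero set of its homogeneous elements.
\<close>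

definition proj_zeros :: "('n::finite, 'k::field) mpoly set \<Rightarrow> ('n \<Rightarrow> 'k) set set" where
  "proj_zeros S =
     {p \<in> proj_space. \<forall>f\<in>S. (\<exists>d. homogeneous d f) \<longrightarrow> (\<forall>v\<in>p. mpoly_eval v f = 0)}"

definition proj_closed :: "('n::finite \<Rightarrow> 'k::field) set set \<Rightarrow> bool" where
  "proj_closed A \<longleftrightarrow> (\<exists>S. A = proj_zeros S)"

definition proj_irreducible :: "('n::finite \<Rightarrow> 'k::field) set set \<Rightarrow> bool" where
  "proj_irreducible A \<longleftrightarrow>
     A \<noteq> {} \<and> (\<forall>B C. proj_closed B \<longrightarrow> proj_closed C \<longrightarrow> A \<subseteq> B \<union> C \<longrightarrow> A \<subseteq> B \<or> A \<subseteq> C)"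

text \<open>
  Topological dimension of a closed set \<open>A\<close>; its irreducible closed subsets are exactly the
  irreducible closed subsets of projective space that are contained in it.
\<close>

definition proj_dim :: "('n::finite \<Rightarrow> 'k::field) set set \<Rightarrow> ereal" where
  "proj_dim A =
     Sup {ereal (real d) | d. \<exists>Zs. length Zs = Suc d \<and> sorted_wrt (\<subset>) Zs \<and>
            (\<forall>Z\<in>set Zs. proj_closed Z \<and> proj_irreducible Z \<and> Z \<subseteq> A)}"

section \<open>The rational map defined by a system\<close>

text \<open>
  The image, as a closed set, of the rational map \<open>(x\<^sub>1 : \<dots> : x\<^sub>n) \<mapsto> (h\<^sub>1(x) : \<dots> : h\<^sub>n(x))\<close>.
\<close>

definition image_locus ::
    "('n::finite \<Rightarrow> ('n, 'k::field) mpoly) \<Rightarrow> ('n \<Rightarrow> 'k) set set" where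
  "image_locus h = proj_zeros {f. mpoly_subst h f = 0}"

definition fundamental_locus ::
    "('n::finite \<Rightarrow> ('n, 'k::field) mpoly) \<Rightarrow> ('n \<Rightarrow> 'k) set set" where
  "fundamental_locus h = proj_zeros (h ` UNIV)"

end

theory Submission
  imports Defs
begin

text \<open>
  The derivation \<open>D = \<Sum>\<^sub>k h\<^sub>k \<partial>/\<partial>x\<^sub>k\<close> kills every \<open>h\<^sub>j\<close>, so for a form \<open>f\<close> of degree \<open>d\<close> one has
  \<open>D\<^sup>d f = d! f(h)\<close>. Hence \<open>h\<^sub>j(h) = 0\<close> as soon as \<open>d > 0\<close>, that is \<open>W \<subseteq> T\<close>, and \<open>dim T \<ge> dim W \<ge> 1\<close>;
  for \<open>d = 0\<close> the set \<open>W\<close> has at most one point. The vanishing ideals of a chain of irreducible closed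
  subsets of \<open>T\<close>, together with the irrelevant ideal, form a chain of primes containing all
  \<open>h\<^sub>j\<close>, so \<open>K[x]/(h)\<close> has dimension at least \<open>dim T + 1\<close>. Conversely, the least prime \<open>P\<close> of a
  chain of primes containing all \<open>h\<^sub>j\<close> contains an irreducible \<open>p\<close>; as \<open>K[x]\<close> is factorial, \<open>(p)\<close> is
  prime, and \<open>(p) \<noteq> P\<close> because the \<open>h\<^sub>j\<close> have no common factor. So the chain can be extended by
  \<open>0 \<subset> (p)\<close>, and chains of primes in \<open>K[x]\<close> have at most \<open>n + 1\<close> members.
\<close>

section \<open>Polynomials in finitely many variables\<close>

text \<open>All bounds come from
  \<open>1 \<le> dim W \<le> dim T \<le> dim K[x]/(h) - 1 \<le> n - 3\<close>. Closed sets see only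
  homogeneous polynomials, while primality speaks of all of them. The bridge is the restriction
  \<open>f(t v)\<close> to a line through the origin: since \<open>K\<close> is infinite,
  \<open>f\<close> vanishes on the punctured line exactly when all its homogeneous components vanish
  at \<open>v\<close>. The length bound for chains of primes rests on counting: one element from
  each gap of a chain that is too long gives \<open>n + 1\<close> polynomials in \<open>n\<close>
  variables, and these are algebraically dependent. Factoriality is an induction on the number of
  variables. As the index type fixes the variables, it runs over the subrings
  \<open>polys_in I\<close>, and Gauss's lemma is carried out with pseudo-division instead of
  fraction fields.\<close>

abbreviation Const :: "'k::zero \<Rightarrow> ('n, 'k) mpoly" where
  "Const c \<equiv> Poly_Mapping.single 0 c"

definition Var :: "'n \<Rightarrow> ('n, 'k::zero_neq_one) mpoly" where
  "Var i = Poly_Mapping.single (Poly_Mapping.single i 1) 1"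

abbreviation coeff_of :: "('n, 'k::zero) mpoly \<Rightarrow> ('n \<Rightarrow>\<^sub>0 nat) \<Rightarrow> 'k" where
  "coeff_of \<equiv> Poly_Mapping.lookup"

abbreviation expo :: "('n \<Rightarrow>\<^sub>0 nat) \<Rightarrow> 'n \<Rightarrow> nat" where
  "expo \<equiv> Poly_Mapping.lookup"

abbreviation monoms :: "('n, 'k::zero) mpoly \<Rightarrow> ('n \<Rightarrow>\<^sub>0 nat) set" where
  "monoms \<equiv> Poly_Mapping.keys"

section \<open>Monomial expansions and evaluation homomorphisms\<close>

lemma mpoly_sum_monoms:
  fixes f :: "('n, 'k::comm_monoid_add) mpoly"
  shows "f = (\<Sum>m\<in>monoms f. Poly_Mapping.single m (coeff_of f m))"
proof (rule poly_mapping_eqI)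
  fix k
  have "coeff_of (\<Sum>m\<in>monoms f. Poly_Mapping.single m (coeff_of f m)) k
      = (\<Sum>m\<in>monoms f. if m = k then coeff_of f m else 0)"
    by (simp add: lookup_sum lookup_single when_def)
  then show "coeff_of f k = coeff_of (\<Sum>m\<in>monoms f. Poly_Mapping.single m (coeff_of f m)) k"
    by (simp add: sum.delta in_keys_iff)
qed

lemma mpoly_induct [case_names monom add]:
  fixes f :: "('n, 'k::comm_monoid_add) mpoly"
  assumes "\<And>m c. P (Poly_Mapping.single m c)" "\<And>f g. P f \<Longrightarrow> P g \<Longrightarrow> P (f + g)"
  shows "P f"
proof -
  have "P (\<Sum>m\<in>A. Poly_Mapping.single m (coeff_of f m))" if "finite A" for A
    using that by induction (use assms(1)[of 0 0] in \<open>auto intro: assms\<close>)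
  then show ?thesis
    using mpoly_sum_monoms[of f] by (metis finite_keys)
qed

text \<open>One set of rules serves five homomorphisms: evaluation into \<open>K\<close>,
  substitution into \<open>K[x]\<close>, and the maps \<open>grading\<close>, \<open>on_line\<close>
  and \<open>wrt\<close> into polynomial rings over these.\<close>

locale coeff_hom =
  fixes \<phi> :: "'k::comm_semiring_1 \<Rightarrow> 'r::comm_semiring_1"
  assumes zero: "\<phi> 0 = 0" and one: "\<phi> 1 = 1"
    and add: "\<phi> (x + y) = \<phi> x + \<phi> y" and mult: "\<phi> (x * y) = \<phi> x * \<phi> y"
begin

lemma eval_hom_superset:
  assumes "finite S" "monoms f \<subseteq> S"
  shows "eval_hom \<phi> a f = (\<Sum>m\<in>S. \<phi> (coeff_of f m) * (\<Prod>i\<in>UNIV. a i ^ expo m i))"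
  unfolding eval_hom_def by (rule sum.mono_neutral_left) (use assms in \<open>auto simp: in_keys_iff zero\<close>)

lemma eval_hom_monom [simp]:
  "eval_hom \<phi> a (Poly_Mapping.single m c) = \<phi> c * (\<Prod>i\<in>UNIV. a i ^ expo m i)"
  by (subst eval_hom_superset[of "{m}"]) (auto simp: zero)

lemma eval_hom_zero [simp]: "eval_hom \<phi> a 0 = 0"
  by (simp add: eval_hom_def)

lemma eval_hom_add: "eval_hom \<phi> a (f + g) = eval_hom \<phi> a f + eval_hom \<phi> a g"
  using eval_hom_superset[of "monoms f \<union> monoms g" "f + g" a]
    eval_hom_superset[of "monoms f \<union> monoms g" f a]
    eval_hom_superset[of "monoms f \<union> monoms g" g a] keys_add[of f g]
  by (simp add: lookup_add add distrib_right sum.distrib)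

lemma eval_hom_sum: "eval_hom \<phi> a (\<Sum>x\<in>A. f x) = (\<Sum>x\<in>A. eval_hom \<phi> a (f x))"
  by (induction A rule: infinite_finite_induct) (auto simp: eval_hom_add)

lemma eval_hom_mult: "eval_hom \<phi> a (f * g) = eval_hom \<phi> a f * eval_hom \<phi> a g"
proof (induction f rule: mpoly_induct)
  case (monom m c)
  show ?case
    by (induction g rule: mpoly_induct)
      (simp_all add: mult_single mult lookup_add power_add prod.distrib eval_hom_add
        distrib_left distrib_right mult_ac)
qed (simp add: distrib_right eval_hom_add)

lemma eval_hom_one [simp]: "eval_hom \<phi> a 1 = 1"
  using eval_hom_monom[of a 0 1] by (simp add: one)

lemma eval_hom_power: "eval_hom \<phi> a (f ^ k) = eval_hom \<phi> a f ^ k"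
  by (induction k) (auto simp: eval_hom_mult)

lemma eval_hom_Var [simp]: "eval_hom \<phi> a (Var i) = a i"
proof -
  have "(\<Prod>j\<in>UNIV. a j ^ expo (Poly_Mapping.single i 1) j) = (\<Prod>j\<in>UNIV. if j = i then a i else 1)"
    by (rule prod.cong) (auto simp: lookup_single when_def)
  then show ?thesis by (simp add: Var_def one)
qed

lemma eval_hom_Const: "eval_hom \<phi> a (Const c) = \<phi> c"
  by simp


end

lemma prod_Var_power:
  fixes m :: "'n::finite \<Rightarrow>\<^sub>0 nat"
  shows "(\<Prod>i\<in>UNIV. Var i ^ expo m i) = (Poly_Mapping.single m 1 :: ('n, 'k::comm_semiring_1) mpoly)"
proof -
  have pow: "Var i ^ k = (Poly_Mapping.single (Poly_Mapping.single i k) 1 :: ('n, 'k) mpoly)" for i k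
    by (induction k) (auto simp: Var_def mult_single single_add[symmetric])
  have "(\<Prod>i\<in>A. Poly_Mapping.single (g i) 1) = (Poly_Mapping.single (\<Sum>i\<in>A. g i) 1 :: ('n, 'k) mpoly)"
    for g and A :: "'n set"
    by (induction A rule: infinite_finite_induct) (auto simp: mult_single)
  moreover have "(\<Sum>i\<in>UNIV. Poly_Mapping.single i (expo m i)) = m"
    by (rule poly_mapping_eqI) (simp add: lookup_sum lookup_single when_def sum.delta)
  ultimately show ?thesis
    by (simp only: pow)
qed

lemma monom_eq_Const_times:
  "Poly_Mapping.single m c = (Const c * (\<Prod>i\<in>UNIV. Var i ^ expo m i) :: ('n::finite, 'k::comm_semiring_1) mpoly)"
  by (simp add: prod_Var_power mult_single)

lemma coeff_hom_id: "coeff_hom (\<lambda>c. c)"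
  by unfold_locales auto

lemma coeff_hom_Const: "coeff_hom Const"
  by unfold_locales (simp_all add: single_add mult_single mult.commute)

lemma coeff_hom_pConst: "coeff_hom (\<lambda>c. [:Const c:])"
  by unfold_locales (simp_all add: single_add mult_single one_pCons mult.commute)

interpretation mpoly_eval: coeff_hom "\<lambda>c. c"
  by (rule coeff_hom_id)

interpretation mpoly_subst: coeff_hom Const
  by (rule coeff_hom_Const)

section \<open>Homogeneous components\<close>

text \<open>This is \<open>f(t x)\<close> as a polynomial in \<open>t\<close>, so the coefficient of
  \<open>t^d\<close> is the part of degree \<open>d\<close>.\<close>

definition grading :: "('n::finite, 'k::comm_semiring_1) mpoly \<Rightarrow> ('n, 'k) mpoly poly" where
  "grading = eval_hom (\<lambda>c. [:Const c:]) (\<lambda>i. monom (Var i) 1)"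

interpretation grading: coeff_hom "\<lambda>c. [:Const c:]"
  by (rule coeff_hom_pConst)

abbreviation hcomp :: "nat \<Rightarrow> ('n::finite, 'k::comm_semiring_1) mpoly \<Rightarrow> ('n, 'k) mpoly" where
  "hcomp d f \<equiv> coeff (grading f) d"

lemma grading_monom:
  fixes m :: "'n::finite \<Rightarrow>\<^sub>0 nat" and c :: "'k::comm_semiring_1"
  shows "grading (Poly_Mapping.single m c) = monom (Poly_Mapping.single m c) (\<Sum>i\<in>UNIV. expo m i)"
proof -
  have prod: "(\<Prod>i\<in>A. monom (g i) (e i)) = (monom (\<Prod>i\<in>A. g i) (\<Sum>i\<in>A. e i) :: ('n, 'k) mpoly poly)"
    for g e and A :: "'n set"
    by (induction A rule: infinite_finite_induct) (simp_all add: mult_monom monom_0)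
  have "grading (Poly_Mapping.single m c) = smult (Const c) (monom (Poly_Mapping.single m 1) (\<Sum>i\<in>UNIV. expo m i))"
    by (simp add: grading_def grading.eval_hom_monom monom_power prod prod_Var_power)
  then show ?thesis
    by (simp add: smult_monom mult_single)
qed

lemma hcomp_eq:
  "hcomp d f = (\<Sum>m | m \<in> monoms f \<and> (\<Sum>i\<in>UNIV. expo m i) = d. Poly_Mapping.single m (coeff_of f m))"
proof -
  have "grading f = (\<Sum>m\<in>monoms f. grading (Poly_Mapping.single m (coeff_of f m)))"
    by (subst mpoly_sum_monoms[of f]) (simp only: grading_def grading.eval_hom_sum)
  then have "hcomp d f = (\<Sum>m\<in>monoms f. if (\<Sum>i\<in>UNIV. expo m i) = d then Poly_Mapping.single m (coeff_of f m) else 0)"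
    by (simp add: grading_monom coeff_sum)
  also have "\<dots> = (\<Sum>m | m \<in> monoms f \<and> (\<Sum>i\<in>UNIV. expo m i) = d. Poly_Mapping.single m (coeff_of f m))"
    by (rule sum.inter_filter[symmetric]) simp
  finally show ?thesis .
qed

lemma coeff_of_hcomp:
  "coeff_of (hcomp d f) m = (if (\<Sum>i\<in>UNIV. expo m i) = d then coeff_of f m else 0)"
proof -
  let ?A = "{m \<in> monoms f. (\<Sum>i\<in>UNIV. expo m i) = d}"
  have "coeff_of (hcomp d f) m = (\<Sum>m'\<in>?A. if m' = m then coeff_of f m' else 0)"
    by (simp only: hcomp_eq lookup_sum lookup_single when_def)
  also have "\<dots> = (if m \<in> ?A then coeff_of f m else 0)"
    by (rule sum.delta) simp
  finally show ?thesis
    by (simp add: in_keys_iff)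
qed

lemma homogeneous_hcomp: "homogeneous d (hcomp d f)"
  unfolding homogeneous_def
proof
  fix m assume "m \<in> monoms (hcomp d f)"
  then have "coeff_of (hcomp d f) m \<noteq> 0"
    by (simp add: in_keys_iff)
  then show "(\<Sum>i\<in>UNIV. expo m i) = d"
    unfolding coeff_of_hcomp by (auto split: if_splits)
qed

lemma poly_grading_1: "poly (grading f) 1 = f"
proof (induction f rule: mpoly_induct)
  case (add f g)
  then show ?case by (simp add: grading_def grading.eval_hom_add)
qed (simp add: grading_monom poly_monom)

lemma sum_hcomp: "f = (\<Sum>d\<le>degree (grading f). hcomp d f)"
proof -
  have "(\<Sum>d\<le>degree (grading f). hcomp d f) = poly (grading f) 1"
    by (simp add: poly_altdef)
  then show ?thesis
    by (simp only: poly_grading_1)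
qed

section \<open>Self-vanishing systems\<close>

lemma partial_deriv_superset:
  assumes "finite S" "monoms f \<subseteq> S"
  shows "partial_deriv k f = (\<Sum>m\<in>S. Poly_Mapping.single (m - Poly_Mapping.single k 1)
    (of_nat (expo m k) * coeff_of f m))"
  unfolding partial_deriv_def by (rule sum.mono_neutral_left) (use assms in \<open>auto simp: in_keys_iff\<close>)

lemma partial_deriv_monom:
  "partial_deriv k (Poly_Mapping.single m c) =
     Poly_Mapping.single (m - Poly_Mapping.single k 1) (of_nat (expo m k) * c)"
  by (subst partial_deriv_superset[of "{m}"]) auto

lemma partial_deriv_add: "partial_deriv k (f + g) = partial_deriv k f + partial_deriv k g"
  using partial_deriv_superset[of "monoms f \<union> monoms g" "f + g" k]
    partial_deriv_superset[of "monoms f \<union> monoms g" f k]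
    partial_deriv_superset[of "monoms f \<union> monoms g" g k] keys_add[of f g]
  by (simp add: lookup_add distrib_left sum.distrib single_add)

text \<open>Exponent subtraction truncates, so the Leibniz rule can move it across a sum only if
  \<open>x_k\<close> occurs; otherwise the factor \<open>of_nat (expo m k)\<close> is zero.\<close>

lemma monom_minus_add:
  fixes m m' :: "'n \<Rightarrow>\<^sub>0 nat"
  assumes "expo m k \<noteq> 0"
  shows "m - Poly_Mapping.single k 1 + m' = m + m' - Poly_Mapping.single k 1"
  by (rule poly_mapping_eqI) (use assms in \<open>auto simp: lookup_add lookup_minus lookup_single when_def\<close>)

lemma partial_deriv_mult_monom:
  "partial_deriv k (Poly_Mapping.single m c * Poly_Mapping.single m' c') =
     Poly_Mapping.single m c * partial_deriv k (Poly_Mapping.single m' c') +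
     partial_deriv k (Poly_Mapping.single m c) * Poly_Mapping.single m' c'"
proof -
  let ?e = "Poly_Mapping.single k 1"
  have 1: "Poly_Mapping.single (m - ?e + m') (of_nat (expo m k) * c * c') =
      Poly_Mapping.single (m + m' - ?e) (of_nat (expo m k) * c * c')"
    using monom_minus_add[of m k m'] by (cases "expo m k = 0") simp_all
  have 2: "Poly_Mapping.single (m + (m' - ?e)) (c * (of_nat (expo m' k) * c')) =
      Poly_Mapping.single (m + m' - ?e) (of_nat (expo m' k) * c * c')"
    using monom_minus_add[of m' k m] by (cases "expo m' k = 0") (simp_all add: ac_simps)
  show ?thesis
    unfolding mult_single partial_deriv_monom 1 2 lookup_add
    by (simp add: single_add[symmetric] algebra_simps)
qed

lemma partial_deriv_mult:
  "partial_deriv k (f * g) = f * partial_deriv k g + partial_deriv k f * g"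
proof (induction f rule: mpoly_induct)
  case (monom m c)
  show ?case
  proof (induction g rule: mpoly_induct)
    case (monom m' c')
    show ?case by (rule partial_deriv_mult_monom)
  next
    case (add f g)
    then show ?case by (simp add: partial_deriv_add distrib_left distrib_right ac_simps)
  qed
next
  case (add f1 f2)
  then show ?case by (simp add: partial_deriv_add distrib_left distrib_right ac_simps)
qed

lemma partial_deriv_Var: "partial_deriv k (Var i) = (if i = k then 1 else 0)"
  unfolding Var_def partial_deriv_monom by (simp add: lookup_single when_def)

section \<open>The derivation attached to a system and its iterates on forms\<close>

definition field_deriv ::
  "('n::finite \<Rightarrow> ('n, 'k::comm_semiring_1) mpoly) \<Rightarrow> ('n, 'k) mpoly \<Rightarrow> ('n, 'k) mpoly" where
  "field_deriv h f = (\<Sum>k\<in>UNIV. h k * partial_deriv k f)"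

lemma field_deriv_add: "field_deriv h (f + g) = field_deriv h f + field_deriv h g"
  by (simp add: field_deriv_def partial_deriv_add distrib_left sum.distrib)

lemma field_deriv_mult: "field_deriv h (f * g) = f * field_deriv h g + field_deriv h f * g"
  by (simp add: field_deriv_def partial_deriv_mult distrib_left sum.distrib sum_distrib_left
      sum_distrib_right ac_simps)

lemma field_deriv_Const: "field_deriv h (Const c) = 0"
  by (simp add: field_deriv_def partial_deriv_monom)

lemma field_deriv_zero: "field_deriv h 0 = 0"
  using field_deriv_Const[of h 0] by simp

lemma field_deriv_Var: "field_deriv h (Var i) = h i"
proof -
  have "field_deriv h (Var i) = (\<Sum>k\<in>UNIV. if k = i then h k else 0)"
    unfolding field_deriv_def by (rule sum.cong) (auto simp: partial_deriv_Var)
  then show ?thesis by simp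
qed

lemma mpoly_subst_Const: "mpoly_subst h (Const c) = Const c"
  by (simp add: mpoly_subst_def mpoly_subst.eval_hom_Const)

lemma mpoly_subst_Var: "mpoly_subst h (Var i) = h i"
  by (simp add: mpoly_subst_def mpoly_subst.eval_hom_Var)

lemma mpoly_subst_mult: "mpoly_subst h (f * g) = mpoly_subst h f * mpoly_subst h g"
  by (simp add: mpoly_subst_def mpoly_subst.eval_hom_mult)

lemma mpoly_subst_add: "mpoly_subst h (f + g) = mpoly_subst h f + mpoly_subst h g"
  by (simp add: mpoly_subst_def mpoly_subst.eval_hom_add)

lemma monom_times_Var:
  fixes c :: "'k::comm_semiring_1"
  shows "Var i * Poly_Mapping.single m c = Poly_Mapping.single (m + Poly_Mapping.single i 1) c"
  by (simp add: Var_def mult_single add.commute)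

text \<open>Monomials are built up one variable at a time, as the Leibniz rule requires; the
  predicate also sees the degree because the number of applications of \<open>D\<close> grows with
  it.\<close>

lemma monom_degree_induct [consumes 1, case_names Const Var]:
  fixes m :: "'n::finite \<Rightarrow>\<^sub>0 nat"
  assumes "(\<Sum>j\<in>UNIV. expo m j) = d"
    and "\<And>c. P 0 (Const c :: ('n, 'k::comm_semiring_1) mpoly)"
    and "\<And>d m c i. (\<Sum>j\<in>UNIV. expo m j) = d \<Longrightarrow> P d (Poly_Mapping.single m c) \<Longrightarrow>
      P (Suc d) (Var i * Poly_Mapping.single m c)"
  shows "P d (Poly_Mapping.single m c)"
  using assms(1)
proof (induction d arbitrary: m)
  case 0
  then have "m = 0"
    by (intro poly_mapping_eqI) simp
  then show ?case using assms(2) by simp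
next
  case (Suc d)
  then obtain i where i: "expo m i \<noteq> 0"
    by (metis sum.neutral nat.simps(3))
  define m' where "m' = m - Poly_Mapping.single i 1"
  have m: "m = m' + Poly_Mapping.single i 1"
    unfolding m'_def
    by (rule poly_mapping_eqI) (use i in \<open>auto simp: lookup_add lookup_minus lookup_single when_def\<close>)
  have "(\<Sum>j\<in>UNIV. expo m j) = (\<Sum>j\<in>UNIV. expo m' j) + 1"
    unfolding m by (simp add: lookup_add sum.distrib lookup_single when_def)
  with Suc.prems have d: "(\<Sum>j\<in>UNIV. expo m' j) = d" by simp
  from assms(3)[OF d Suc.IH[OF d]] show ?case
    by (simp only: monom_times_Var m)
qed

context
  fixes h :: "'n::finite \<Rightarrow> ('n, 'k::field_char_0) mpoly"
  assumes self_vanishing: "\<And>j. field_deriv h (h j) = 0"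
begin

text \<open>The kernel of a derivation is a subalgebra, and \<open>D\<close> kills the constants and
  all \<open>h j\<close>.\<close>

lemma field_deriv_subst: "field_deriv h (mpoly_subst h f) = 0"
proof (induction f rule: mpoly_induct)
  case (monom m c)
  have "(\<Sum>j\<in>UNIV. expo m j) = (\<Sum>j\<in>UNIV. expo m j)" ..
  then show ?case
    by (induction rule: monom_degree_induct)
      (simp_all add: mpoly_subst_Const field_deriv_Const mpoly_subst_mult mpoly_subst_Var
        field_deriv_mult self_vanishing)
qed (simp add: mpoly_subst_add field_deriv_add)

lemma field_deriv_iterate_zero: "(field_deriv h ^^ r) 0 = 0"
  by (induction r) (simp_all add: field_deriv_zero)

lemma field_deriv_iterate_add:
  "(field_deriv h ^^ r) (f + g) = (field_deriv h ^^ r) f + (field_deriv h ^^ r) g"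
  by (induction r) (simp_all add: field_deriv_add)

text \<open>Only two terms of the Leibniz formula survive, since \<open>D\<close> sends
  \<open>Var i\<close> to \<open>h i\<close> and kills \<open>h i\<close>.\<close>

lemma field_deriv_iterate_Var:
  "(field_deriv h ^^ Suc r) (Var i * g) =
     Var i * (field_deriv h ^^ Suc r) g + of_nat (Suc r) * (h i * (field_deriv h ^^ r) g)"
proof (induction r)
  case 0
  show ?case by (simp add: field_deriv_mult field_deriv_Var)
next
  case (Suc r)
  have of_nat: "field_deriv h (of_nat n) = 0" for n
    using field_deriv_Const[of h "of_nat n"] by simp
  have "(field_deriv h ^^ Suc (Suc r)) (Var i * g) = field_deriv h (Var i * (field_deriv h ^^ Suc r) g
      + of_nat (Suc r) * (h i * (field_deriv h ^^ r) g))"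
    using Suc by simp
  also have "\<dots> = Var i * (field_deriv h ^^ Suc (Suc r)) g + h i * (field_deriv h ^^ Suc r) g
      + of_nat (Suc r) * (h i * (field_deriv h ^^ Suc r) g)"
    by (simp only: field_deriv_add field_deriv_mult field_deriv_Var self_vanishing of_nat) simp
  finally show ?case
    by (simp add: algebra_simps)
qed

text \<open>Since \<open>D\<close> kills the image of the substitution, each application of \<open>D\<close> to a form turns one
  factor \<open>x\<^sub>i\<close> of every monomial into \<open>h\<^sub>i\<close>.\<close>

lemma field_deriv_iterate_monom:
  assumes "(\<Sum>j\<in>UNIV. expo m j) = d"
  shows "(field_deriv h ^^ d) (Poly_Mapping.single m c) = fact d * mpoly_subst h (Poly_Mapping.single m c)"
  using assms
proof (induction rule: monom_degree_induct)
  case (Const c)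
  then show ?case by (simp add: mpoly_subst_Const)
next
  case (Var d m c i)
  let ?g = "Poly_Mapping.single m c"
  \<comment> \<open>Constants pass through the substitution, so this product is again in its image
    and \<open>D\<close> kills it. The term that keeps the factor \<open>Var i\<close> then
    disappears.\<close>
  have fact: "fact d * mpoly_subst h ?g = mpoly_subst h (fact d * ?g)"
  proof -
    have "mpoly_subst h (of_nat n) = of_nat n" for n
      using mpoly_subst_Const[of h "of_nat n"] by (simp only: single_of_nat)
    from this[of "fact d"] show ?thesis
      by (simp add: mpoly_subst_mult)
  qed
  have "(field_deriv h ^^ Suc d) ?g = 0"
    using Var by (simp only: funpow.simps comp_def fact field_deriv_subst)
  then show ?case
    unfolding field_deriv_iterate_Var Var.IH
    by (simp add: mpoly_subst_mult mpoly_subst_Var algebra_simps)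
qed

lemma field_deriv_iterate_homogeneous:
  assumes "homogeneous d f"
  shows "(field_deriv h ^^ d) f = fact d * mpoly_subst h f"
proof -
  have "(field_deriv h ^^ d) (\<Sum>m\<in>A. Poly_Mapping.single m (coeff_of f m)) =
      fact d * mpoly_subst h (\<Sum>m\<in>A. Poly_Mapping.single m (coeff_of f m))"
    if "A \<subseteq> monoms f" for A
  proof -
    have "finite A" using that by (rule finite_subset) simp
    then show ?thesis using that
    proof induction
      case empty
      show ?case by (simp add: field_deriv_iterate_zero mpoly_subst_def)
    next
      case (insert m A)
      then have "(\<Sum>j\<in>UNIV. expo m j) = d"
        using assms by (auto simp: homogeneous_def)
      with insert show ?case
        by (simp add: field_deriv_iterate_add field_deriv_iterate_monom mpoly_subst_add distrib_left)
    qed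
  qed
  from this[of "monoms f"] show ?thesis
    by (simp only: subset_refl simp_thms mpoly_sum_monoms[of f, symmetric])
qed

text \<open>Of the \<open>d\<close> applications of \<open>D\<close> already the first gives zero,
  and \<open>d!\<close> is invertible in characteristic zero.\<close>

lemma subst_self_vanishing:
  assumes "homogeneous d (h j)" "d > 0"
  shows "mpoly_subst h (h j) = 0"
proof -
  obtain r where d: "d = Suc r" using assms(2) by (cases d) auto
  have "fact d * mpoly_subst h (h j) = (field_deriv h ^^ r) (field_deriv h (h j))"
    using field_deriv_iterate_homogeneous[OF assms(1)] by (simp only: d funpow_Suc_right comp_def)
  also have "\<dots> = 0"
    by (simp add: self_vanishing field_deriv_iterate_zero)
  finally have *: "fact d * mpoly_subst h (h j) = 0" .
  have "Const (inverse (fact d)) * (fact d :: ('n, 'k) mpoly) = Const (inverse (fact d)) * Const (fact d)"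
    by (metis of_nat_fact single_of_nat)
  also have "\<dots> = 1"
    by (simp add: mult_single)
  finally have "mpoly_subst h (h j) = Const (inverse (fact d)) * (fact d * mpoly_subst h (h j))"
    by (simp only: mult.assoc[symmetric] mult_1)
  then show ?thesis
    by (simp only: * mult_zero_right)
qed

end

section \<open>Prime ideals and Krull dimension\<close>

text \<open>Stated on sets in a type-class ring to keep the algebra free of ring records;
  \<open>primeideal_ring_of_type_algebra_iff\<close> connects it with the notion behind
  \<open>krull_dim\<close>.\<close>

definition prime_ideal :: "'a::comm_ring_1 set \<Rightarrow> bool" where
  "prime_ideal P \<longleftrightarrow> 0 \<in> P \<and> (\<forall>a\<in>P. \<forall>b\<in>P. a + b \<in> P) \<and> (\<forall>a. \<forall>b\<in>P. a * b \<in> P) \<and>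
     1 \<notin> P \<and> (\<forall>a b. a * b \<in> P \<longrightarrow> a \<in> P \<or> b \<in> P)"

lemma prime_idealD:
  assumes "prime_ideal P"
  shows "0 \<in> P" "1 \<notin> P" "a \<in> P \<Longrightarrow> b \<in> P \<Longrightarrow> a + b \<in> P" "b \<in> P \<Longrightarrow> a * b \<in> P"
    "b \<in> P \<Longrightarrow> b * a \<in> P" "a * b \<in> P \<Longrightarrow> a \<in> P \<or> b \<in> P"
  using assms by (auto simp: prime_ideal_def mult.commute)

lemma prime_ideal_uminus: "prime_ideal P \<Longrightarrow> a \<in> P \<Longrightarrow> - a \<in> P"
  using prime_idealD(4)[of P a "- 1"] by simp

lemma prime_ideal_diff: "prime_ideal P \<Longrightarrow> a \<in> P \<Longrightarrow> b \<in> P \<Longrightarrow> a - b \<in> P"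
  using prime_idealD(3)[of P a "- b"] prime_ideal_uminus by fastforce

lemma prime_ideal_power: "prime_ideal P \<Longrightarrow> a ^ k \<in> P \<Longrightarrow> a \<in> P"
  by (induction k) (auto dest: prime_idealD)

lemma primeideal_ring_of_type_algebra_iff:
  "primeideal P (ring_of_type_algebra :: 'a::comm_ring_1 ring) \<longleftrightarrow> prime_ideal P"
proof
  assume "primeideal P (ring_of_type_algebra :: 'a ring)"
  then interpret primeideal P "ring_of_type_algebra :: 'a ring" .
  have "1 \<notin> P"
    using I_notcarr one_imp_carrier by (auto simp: ring_of_type_algebra_def)
  then show "prime_ideal P"
    using additive_subgroup.zero_closed[OF additive_subgroup_axioms]
      additive_subgroup.a_closed[OF additive_subgroup_axioms] I_l_closed I_prime
    by (auto simp: prime_ideal_def ring_of_type_algebra_def)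
next
  assume P: "prime_ideal P"
  show "primeideal P (ring_of_type_algebra :: 'a ring)"
  proof (rule primeidealI)
    show "cring (ring_of_type_algebra :: 'a ring)"
      by (rule cring_from_type_algebra)
    show "ideal P (ring_of_type_algebra :: 'a ring)"
    proof (rule idealI)
      show "ring (ring_of_type_algebra :: 'a ring)"
        by (rule ring_from_type_algebra)
      show "subgroup P (add_monoid (ring_of_type_algebra :: 'a ring))"
      proof (rule group.subgroupI)
        show "group (add_monoid (ring_of_type_algebra :: 'a ring))"
          using ring_from_type_algebra abelian_group.a_group ring.is_abelian_group by blast
        then interpret group "add_monoid (ring_of_type_algebra :: 'a ring)" .
        fix a assume a: "a \<in> P"
        have "inv\<^bsub>add_monoid (ring_of_type_algebra :: 'a ring)\<^esub> a = - a"
          by (rule inv_equality) (auto simp: ring_of_type_algebra_def)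
        then show "inv\<^bsub>add_monoid (ring_of_type_algebra :: 'a ring)\<^esub> a \<in> P"
          using P a by (simp add: prime_ideal_uminus)
      qed (use prime_idealD[OF P] in \<open>auto simp: ring_of_type_algebra_def\<close>)
    qed (use prime_idealD[OF P] in \<open>auto simp: ring_of_type_algebra_def\<close>)
  qed (use P in \<open>auto simp: prime_ideal_def ring_of_type_algebra_def mult.commute\<close>)
qed

text \<open>An ideal \<open>J\<close> above \<open>I\<close> is a union of cosets of
  \<open>I\<close>, so a coset lies in the image exactly when its representative lies in
  \<open>J\<close>.\<close>

lemma (in cring) primeideal_quot_iff:
  assumes "ideal I R" "ideal J R" "I \<subseteq> J"
  shows "primeideal ((+>) I ` J) (R Quot I) \<longleftrightarrow> primeideal J R"
proof -
  interpret I: ideal I R by fact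
  interpret hom: ring_hom_ring R "R Quot I" "(+>) I" by (rule I.rcos_ring_hom_ring)
  have idl: "ideal ((+>) I ` J) (R Quot I)"
    using assms ring_ideal_imp_quot_ideal by blast
  then have sub: "(+>) I ` J \<subseteq> carrier (R Quot I)"
    using additive_subgroup.a_subset ideal_def by blast
  have union: "\<Union> ((+>) I ` J) = J"
    using assms ideal_incl_iff by auto
  have mem: "I +> a \<in> (+>) I ` J \<longleftrightarrow> a \<in> J" if "a \<in> carrier R" for a
    using canonical_proj_vimage_mem_iff[OF assms(1) sub that] union by simp
  show ?thesis
  proof
    assume "primeideal ((+>) I ` J) (R Quot I)"
    then have "primeideal {r \<in> carrier R. I +> r \<in> (+>) I ` J} R"
      by (rule hom.primeideal_vimage[OF is_cring])
    moreover have "{r \<in> carrier R. I +> r \<in> (+>) I ` J} = J"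
      using mem ideal.Icarr[OF assms(2)] by blast
    ultimately show "primeideal J R" by simp
  next
    assume "primeideal J R"
    then interpret J: primeideal J R .
    have carr: "\<exists>r\<in>carrier R. x = I +> r" if "x \<in> carrier (R Quot I)" for x
      using that unfolding FactRing_def A_RCOSETS_def'[of R I] by simp
    show "primeideal ((+>) I ` J) (R Quot I)"
    proof (rule primeidealI)
      show "ideal ((+>) I ` J) (R Quot I)" by fact
      show "cring (R Quot I)" by (rule I.quotient_is_cring[OF is_cring])
      show "carrier (R Quot I) \<noteq> (+>) I ` J"
      proof
        assume "carrier (R Quot I) = (+>) I ` J"
        then have "carrier R \<subseteq> J"
          using mem hom.hom_closed by blast
        then show False using J.I_notcarr J.Icarr by blast
      qed
      fix x y assume "x \<in> carrier (R Quot I)" "y \<in> carrier (R Quot I)" and xy: "x \<otimes>\<^bsub>R Quot I\<^esub> y \<in> (+>) I ` J"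
      then obtain a b where ab: "a \<in> carrier R" "b \<in> carrier R" "x = I +> a" "y = I +> b"
        using carr by meson
      have "x \<otimes>\<^bsub>R Quot I\<^esub> y = I +> (a \<otimes> b)"
        unfolding ab(3,4) by (rule hom.hom_mult[symmetric]) (use ab in auto)
      with xy have "I +> (a \<otimes> b) \<in> (+>) I ` J" by (simp only:)
      with ab have "a \<otimes> b \<in> J" using mem[of "a \<otimes> b"] by (simp only: m_closed)
      with ab show "x \<in> (+>) I ` J \<or> y \<in> (+>) I ` J"
        using J.I_prime mem by blast
    qed
  qed
qed

section \<open>Krull dimension of a quotient ring\<close>

lemma sorted_wrt_psubset_map_iff:
  assumes "\<And>A B. A \<in> set As \<Longrightarrow> B \<in> set As \<Longrightarrow> F A \<subset> F B \<longleftrightarrow> A \<subset> B"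
  shows "sorted_wrt (\<subset>) (map F As) \<longleftrightarrow> sorted_wrt (\<subset>) As"
  using assms by (simp add: sorted_wrt_map sorted_wrt_iff_nth_less)

text \<open>The correspondence of ideals preserves and reflects strict inclusion, because the union
  of the cosets in the image of \<open>J\<close> is \<open>J\<close> again; so chains of primes
  correspond.\<close>

lemma (in cring) krull_dim_quot:
  assumes "ideal I R"
  shows "krull_dim (R Quot I) = Sup {ereal (real d) | d. \<exists>Ps. length Ps = Suc d \<and>
    sorted_wrt (\<subset>) Ps \<and> (\<forall>P\<in>set Ps. primeideal P R \<and> I \<subseteq> P)}"
proof -
  let ?F = "\<lambda>J. (+>) I ` J" and ?A = "{J. ideal J R \<and> I \<subseteq> J}"
  have bij: "bij_betw ?F ?A {J. ideal J (R Quot I)}"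
    by (rule quot_ideal_correspondence[OF assms])
  have U: "\<Union> (?F J) = J" if "J \<in> ?A" for J
    using that ideal_incl_iff[OF assms, of J] by (metis (no_types, lifting) mem_Collect_eq)
  have mono: "?F J \<subset> ?F J' \<longleftrightarrow> J \<subset> J'" if "J \<in> ?A" "J' \<in> ?A" for J J'
  proof
    assume "?F J \<subset> ?F J'"
    then have "\<Union> (?F J) \<subseteq> \<Union> (?F J')" "?F J \<noteq> ?F J'" by blast+
    then show "J \<subset> J'" using U that by auto
  next
    assume "J \<subset> J'"
    moreover have "?F J \<noteq> ?F J'" using U that \<open>J \<subset> J'\<close> by (metis psubset_eq)
    ultimately show "?F J \<subset> ?F J'" by blast
  qed
  have "(\<exists>Ps. length Ps = Suc d \<and> sorted_wrt (\<subset>) Ps \<and> (\<forall>P\<in>set Ps. primeideal P (R Quot I))) \<longleftrightarrow>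
    (\<exists>Ps. length Ps = Suc d \<and> sorted_wrt (\<subset>) Ps \<and> (\<forall>P\<in>set Ps. primeideal P R \<and> I \<subseteq> P))"
    (is "?L \<longleftrightarrow> ?R") for d
  proof
    assume ?L
    then obtain Ps where Ps: "length Ps = Suc d" "sorted_wrt (\<subset>) Ps"
      "\<forall>P\<in>set Ps. primeideal P (R Quot I)" by blast
    have "Ps \<in> lists (?F ` ?A)"
      unfolding bij_betw_imp_surj_on[OF bij] lists_eq_set using Ps(3) primeideal.axioms(1) by blast
    then obtain Qs where "Ps = map ?F Qs" "Qs \<in> lists ?A"
      unfolding lists_image by blast
    then have Qs: "Ps = map ?F Qs" "set Qs \<subseteq> ?A"
      unfolding lists_eq_set by blast+
    have "sorted_wrt (\<subset>) (map ?F Qs) \<longleftrightarrow> sorted_wrt (\<subset>) Qs"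
      by (rule sorted_wrt_psubset_map_iff, rule mono) (use Qs(2) in auto)
    then have "sorted_wrt (\<subset>) Qs"
      using Ps(2) Qs(1) by simp
    moreover have "primeideal Q R \<and> I \<subseteq> Q" if "Q \<in> set Qs" for Q
    proof -
      have "ideal Q R" "I \<subseteq> Q" "primeideal (?F Q) (R Quot I)"
        using that Qs Ps(3) by auto
      then show ?thesis
        using primeideal_quot_iff[OF assms] by simp
    qed
    ultimately show ?R
      using Ps(1) Qs(1) by (intro exI[of _ Qs]) auto
  next
    assume ?R
    then obtain Ps where Ps: "length Ps = Suc d" "sorted_wrt (\<subset>) Ps"
      "\<forall>P\<in>set Ps. primeideal P R \<and> I \<subseteq> P" by blast
    then have A: "set Ps \<subseteq> ?A"
      using primeideal.axioms(1) by blast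
    have "sorted_wrt (\<subset>) (map ?F Ps) \<longleftrightarrow> sorted_wrt (\<subset>) Ps"
      by (rule sorted_wrt_psubset_map_iff, rule mono) (use A in auto)
    then have "sorted_wrt (\<subset>) (map ?F Ps)"
      using Ps(2) by simp
    moreover have "primeideal (?F P) (R Quot I)" if "P \<in> set Ps" for P
    proof -
      have "ideal P R" "I \<subseteq> P" "primeideal P R"
        using that A Ps(3) by auto
      then show ?thesis
        using primeideal_quot_iff[OF assms] by simp
    qed
    ultimately show ?L
      using Ps(1) by (intro exI[of _ "map ?F Ps"]) auto
  qed
  then show ?thesis unfolding krull_dim_def by simp
qed

lemma krull_dim_system_quotient:
  fixes h :: "'n \<Rightarrow> ('n, 'k::comm_ring_1) mpoly"
  shows "krull_dim (system_quotient h) = Sup {ereal (real d) | d. \<exists>Ps. length Ps = Suc d \<and>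
    sorted_wrt (\<subset>) Ps \<and> (\<forall>P\<in>set Ps. prime_ideal P \<and> range h \<subseteq> P)}"
proof -
  let ?R = "ring_of_type_algebra :: ('n, 'k) mpoly ring"
  interpret R: cring ?R by (rule cring_from_type_algebra)
  have carr: "range h \<subseteq> carrier ?R" by (simp add: ring_of_type_algebra_def)
  have "Idl\<^bsub>?R\<^esub> (range h) \<subseteq> P \<longleftrightarrow> range h \<subseteq> P" if "primeideal P ?R" for P
    using R.genideal_minimal[of P "range h"] R.genideal_self[OF carr] that primeideal.axioms(1)
    by blast
  then have "(primeideal P ?R \<and> Idl\<^bsub>?R\<^esub> (range h) \<subseteq> P) \<longleftrightarrow> (prime_ideal P \<and> range h \<subseteq> P)" for P
    using primeideal_ring_of_type_algebra_iff[of P] by blast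
  then show ?thesis
    unfolding system_quotient_def R.krull_dim_quot[OF R.genideal_ideal[OF carr]] by simp
qed

section \<open>Vanishing ideals\<close>

lemma mpoly_eval_add: "mpoly_eval v (f + g) = mpoly_eval v f + mpoly_eval v g"
  by (simp add: mpoly_eval_def mpoly_eval.eval_hom_add)

lemma mpoly_eval_mult: "mpoly_eval v (f * g) = mpoly_eval v f * mpoly_eval v g"
  by (simp add: mpoly_eval_def mpoly_eval.eval_hom_mult)

lemma mpoly_eval_zero: "mpoly_eval v 0 = 0"
  by (simp add: mpoly_eval_def)

lemma mpoly_eval_one: "mpoly_eval v 1 = 1"
  by (simp add: mpoly_eval_def mpoly_eval.eval_hom_one)

lemma mpoly_eval_Const: "mpoly_eval v (Const c) = c"
  by (simp add: mpoly_eval_def mpoly_eval.eval_hom_Const)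

lemma mpoly_eval_Var: "mpoly_eval v (Var i) = v i"
  by (simp add: mpoly_eval_def mpoly_eval.eval_hom_Var)

lemma mpoly_eval_diff:
  fixes f :: "('n::finite, 'k::comm_ring_1) mpoly"
  shows "mpoly_eval v (f - g) = mpoly_eval v f - mpoly_eval v g"
  using mpoly_eval_add[of v "f - g" g] by simp

text \<open>This is \<open>f(t v)\<close> as a polynomial in \<open>t\<close>, the restriction of
  \<open>f\<close> to the line through the origin and \<open>v\<close>.\<close>

definition on_line :: "('n::finite \<Rightarrow> 'k::comm_semiring_1) \<Rightarrow> ('n, 'k) mpoly \<Rightarrow> 'k poly" where
  "on_line v = eval_hom (\<lambda>c. monom c 0) (\<lambda>i. monom (v i) 1)"

lemma coeff_hom_monom_0: "coeff_hom (\<lambda>c. monom c 0)"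
  by unfold_locales (simp_all add: monom_0 mult_monom add_monom mult.commute)

interpretation on_line: coeff_hom "\<lambda>c. monom c 0"
  by (rule coeff_hom_monom_0)

lemma on_line_add: "on_line v (f + g) = on_line v f + on_line v g"
  by (simp add: on_line_def on_line.eval_hom_add)

lemma on_line_mult: "on_line v (f * g) = on_line v f * on_line v g"
  by (simp add: on_line_def on_line.eval_hom_mult)

lemma on_line_monom:
  "on_line v (Poly_Mapping.single m c) =
    monom (c * (\<Prod>i\<in>UNIV. v i ^ expo m i)) (\<Sum>i\<in>UNIV. expo m i)"
proof -
  have "(\<Prod>i\<in>A. monom (g i) (e i)) = monom (\<Prod>i\<in>A. g i) (\<Sum>i\<in>A. e i)"
    for g :: "'b \<Rightarrow> 'a" and e and A
    by (induction A rule: infinite_finite_induct) (simp_all add: mult_monom monom_0)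
  then show ?thesis
    by (simp add: on_line_def on_line.eval_hom_monom monom_power mult_monom)
qed

lemma poly_on_line: "poly (on_line v f) c = mpoly_eval (\<lambda>i. c * v i) f"
proof (induction f rule: mpoly_induct)
  case (monom m d)
  show ?case
    by (simp add: on_line_monom poly_monom mpoly_eval_def mpoly_eval.eval_hom_monom
        power_mult_distrib prod.distrib power_sum ac_simps)
qed (simp add: on_line_add mpoly_eval_add)

text \<open>Hence \<open>on_line v f = 0\<close> means that all homogeneous components of
  \<open>f\<close> vanish at \<open>v\<close>.\<close>

lemma coeff_on_line: "coeff (on_line v f) d = mpoly_eval v (hcomp d f)"
proof (induction f rule: mpoly_induct)
  case (monom m c)
  show ?case
    by (simp add: on_line_monom grading_monom mpoly_eval_def mpoly_eval.eval_hom_monom)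
next
  case (add f g)
  then show ?case
    by (simp add: on_line_add grading_def grading.eval_hom_add mpoly_eval_add)
qed

lemma mpoly_eval_eq_on_line: "mpoly_eval v f = poly (on_line v f) 1"
  by (simp add: poly_on_line)

lemma hcomp_homogeneous:
  assumes "homogeneous d f"
  shows "hcomp e f = (if e = d then f else 0)"
  by (rule poly_mapping_eqI)
    (use assms in \<open>auto simp: coeff_of_hcomp homogeneous_def in_keys_iff\<close>)

lemma mpoly_eval_scale:
  assumes "homogeneous d f"
  shows "mpoly_eval (\<lambda>i. c * v i) f = c ^ d * mpoly_eval v f"
proof -
  have "on_line v f = monom (mpoly_eval v f) d"
    by (rule poly_eqI) (simp add: coeff_on_line hcomp_homogeneous[OF assms] mpoly_eval_zero)
  then show ?thesis
    using poly_on_line[of v f c] by (simp add: poly_monom mult.commute)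
qed

text \<open>A nonzero polynomial in \<open>t\<close> has finitely many roots, but \<open>K\<close>
  is infinite. The value \<open>c = 0\<close> is left out since a projective point consists of
  nonzero multiples only.\<close>

lemma on_line_eq_0:
  fixes v :: "'n::finite \<Rightarrow> 'k::field_char_0"
  assumes "\<And>c. c \<noteq> 0 \<Longrightarrow> mpoly_eval (\<lambda>i. c * v i) f = 0"
  shows "on_line v f = 0"
proof (rule ccontr)
  assume "on_line v f \<noteq> 0"
  then have "finite {c. poly (on_line v f) c = 0}" by (rule poly_roots_finite)
  moreover have "- {0} \<subseteq> {c. poly (on_line v f) c = 0}"
    using assms by (auto simp: poly_on_line)
  ultimately have "finite (- {0 :: 'k})" by (rule rev_finite_subset)
  then show False
    using infinite_UNIV_char_0[where 'a = 'k] by (simp add: finite_compl)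
qed

section \<open>Projective points, closed sets and their ideals\<close>

lemma proj_space_scale:
  assumes "p \<in> proj_space" "v \<in> p" "c \<noteq> 0"
  shows "(\<lambda>i. c * v i) \<in> p"
proof -
  obtain u where u: "u \<noteq> (\<lambda>_. 0)" "p = proj_rel `` {u}"
    using assms(1) by (auto simp: proj_space_def elim: quotientE)
  then obtain e where "v \<noteq> (\<lambda>_. 0)" "e \<noteq> 0" "v = (\<lambda>i. e * u i)"
    using assms(2) by (auto simp: proj_rel_def)
  then show ?thesis
    using u assms(3)
    by (auto simp: proj_rel_def fun_eq_iff mult.assoc intro!: exI[of _ "c * e"])
qed

lemma proj_space_nonzero: "p \<in> proj_space \<Longrightarrow> v \<in> p \<Longrightarrow> v \<noteq> (\<lambda>_. 0)"
  by (auto simp: proj_space_def proj_rel_def elim!: quotientE)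

lemma proj_space_scaled:
  assumes "p \<in> proj_space" "v \<in> p" "w \<in> p"
  shows "\<exists>c. c \<noteq> 0 \<and> w = (\<lambda>i. c * v i)"
proof -
  obtain u where u: "u \<noteq> (\<lambda>_. 0)" "p = proj_rel `` {u}"
    using assms(1) by (auto simp: proj_space_def elim: quotientE)
  then obtain c d where "c \<noteq> 0" "d \<noteq> 0" "v = (\<lambda>i. c * u i)" "w = (\<lambda>i. d * u i)"
    using assms(2,3) by (auto simp: proj_rel_def)
  then show ?thesis
    by (intro exI[of _ "d / c"]) simp
qed

lemma proj_space_nonempty: "p \<in> proj_space \<Longrightarrow> \<exists>v. v \<in> p"
  using equiv_proj_rel in_quotient_imp_non_empty unfolding proj_space_def by blast

lemma proj_space_eqI:
  assumes "p \<in> proj_space" "q \<in> proj_space" "v \<in> p" "v \<in> q"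
  shows "p = q"
  using assms quotient_disj[OF equiv_proj_rel] unfolding proj_space_def by blast

text \<open>Evaluation at all representatives of a point tests vanishing on a whole punctured line,
  so inhomogeneous \<open>f\<close> make sense.\<close>

definition vanishing_ideal :: "('n::finite \<Rightarrow> 'k::field) set set \<Rightarrow> ('n, 'k) mpoly set" where
  "vanishing_ideal Z = {f. \<forall>p\<in>Z. \<forall>v\<in>p. mpoly_eval v f = 0}"

lemma on_line_vanishing_ideal:
  fixes v :: "'n::finite \<Rightarrow> 'k::field_char_0"
  assumes "p \<in> proj_space" "p \<in> Z" "v \<in> p" "f \<in> vanishing_ideal Z"
  shows "on_line v f = 0"
  using assms proj_space_scale[OF assms(1,3)]
  by (intro on_line_eq_0) (auto simp: vanishing_ideal_def)

text \<open>\<open>proj_zeros\<close> takes only homogeneous equations into account, so the closed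
  set belonging to an arbitrary \<open>f\<close> is cut out by its components.\<close>

lemma mem_proj_zeros_hcomp:
  assumes "p \<in> proj_space" "v \<in> p" "on_line v f = 0"
  shows "p \<in> proj_zeros (range (\<lambda>d. hcomp d f))"
proof -
  have "mpoly_eval w (hcomp d f) = 0" if "w \<in> p" for w d
  proof -
    from proj_space_scaled[OF assms(1,2) that] obtain c where "w = (\<lambda>i. c * v i)"
      by blast
    moreover have "mpoly_eval v (hcomp d f) = 0"
      using assms(3) by (metis coeff_0 coeff_on_line)
    ultimately show ?thesis
      by (simp add: mpoly_eval_scale[OF homogeneous_hcomp])
  qed
  then show ?thesis
    using assms(1) by (auto simp: proj_zeros_def)
qed

lemma subset_proj_zeros_hcomp:
  assumes "Z \<subseteq> proj_zeros (range (\<lambda>d. hcomp d f))"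
  shows "f \<in> vanishing_ideal Z"
  unfolding vanishing_ideal_def
proof (intro CollectI ballI)
  fix p v assume "p \<in> Z" "v \<in> p"
  then have "mpoly_eval v (hcomp d f) = 0" for d
    using assms homogeneous_hcomp[of d f] by (auto simp: proj_zeros_def)
  then have "on_line v f = 0"
    by (intro poly_eqI) (simp add: coeff_on_line)
  then show "mpoly_eval v f = 0"
    by (simp add: mpoly_eval_eq_on_line)
qed

text \<open>If \<open>f * g\<close> vanishes on \<open>Z\<close>, then on the line over each point
  one factor vanishes identically, as \<open>K[t]\<close> is a domain. So two closed sets cover
  \<open>Z\<close>, and irreducibility selects one.\<close>

lemma prime_ideal_vanishing_ideal:
  fixes Z :: "('n::finite \<Rightarrow> 'k::field_char_0) set set"
  assumes "proj_irreducible Z" "Z \<subseteq> proj_space"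
  shows "prime_ideal (vanishing_ideal Z)"
proof -
  obtain p v where p: "p \<in> Z" "v \<in> p"
    using assms proj_space_nonempty by (fastforce simp: proj_irreducible_def)
  have "f \<in> vanishing_ideal Z \<or> g \<in> vanishing_ideal Z" if fg: "f * g \<in> vanishing_ideal Z" for f g
  proof -
    let ?B = "proj_zeros (range (\<lambda>d. hcomp d f))" and ?C = "proj_zeros (range (\<lambda>d. hcomp d g))"
    have "Z \<subseteq> ?B \<union> ?C"
    proof
      fix q assume q: "q \<in> Z"
      then have qs: "q \<in> proj_space" using assms by blast
      then obtain w where w: "w \<in> q" using proj_space_nonempty by blast
      have "on_line w f * on_line w g = 0"
        using on_line_vanishing_ideal[OF qs q w fg] by (simp add: on_line_mult)
      then show "q \<in> ?B \<union> ?C"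
        using mem_proj_zeros_hcomp[OF qs w] by auto
    qed
    then have "Z \<subseteq> ?B \<or> Z \<subseteq> ?C"
      using assms(1) by (auto simp: proj_irreducible_def proj_closed_def)
    then show ?thesis using subset_proj_zeros_hcomp by blast
  qed
  moreover have "1 \<notin> vanishing_ideal Z"
    using p by (auto simp: vanishing_ideal_def mpoly_eval_one)
  ultimately show ?thesis
    by (auto simp: prime_ideal_def vanishing_ideal_def mpoly_eval_add mpoly_eval_mult mpoly_eval_zero)
qed

text \<open>A closed set can be recovered from its vanishing ideal, because the homogeneous
  equations that define it lie there.\<close>

lemma vanishing_ideal_psubset:
  assumes "proj_closed Z" "proj_closed Z'" "Z \<subset> Z'"
  shows "vanishing_ideal Z' \<subset> vanishing_ideal Z"
proof -
  obtain S S' where S: "Z = proj_zeros S" "Z' = proj_zeros S'"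
    using assms by (auto simp: proj_closed_def)
  have "Z' \<subseteq> Z" if "vanishing_ideal Z \<subseteq> vanishing_ideal Z'"
  proof
    fix p assume p: "p \<in> Z'"
    then have "mpoly_eval v f = 0" if "f \<in> S" "homogeneous d f" "v \<in> p" for f d v
      using that \<open>vanishing_ideal Z \<subseteq> vanishing_ideal Z'\<close>
      by (auto simp: S(1) proj_zeros_def vanishing_ideal_def)
    then show "p \<in> Z"
      using p by (auto simp: S proj_zeros_def)
  qed
  moreover have "vanishing_ideal Z' \<subseteq> vanishing_ideal Z"
    using assms(3) by (auto simp: vanishing_ideal_def)
  ultimately show ?thesis using assms(3) by blast
qed

text \<open>The ideal generated by the variables, in a form that makes its primality
  immediate.\<close>

definition irrelevant_ideal :: "('n::finite, 'k::comm_semiring_1) mpoly set" where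
  "irrelevant_ideal = {f. mpoly_eval (\<lambda>_. 0) f = 0}"

lemma prime_ideal_irrelevant_ideal: "prime_ideal (irrelevant_ideal :: ('n::finite, 'k::field) mpoly set)"
  by (auto simp: prime_ideal_def irrelevant_ideal_def mpoly_eval_add mpoly_eval_mult
      mpoly_eval_zero mpoly_eval_one)

text \<open>A polynomial vanishing on a punctured line also vanishes at \<open>t = 0\<close>; a
  variable that is nonzero at some point of \<open>Z\<close> makes the inclusion strict. This extra
  prime is the \<open>+ 1\<close> between projective and Krull dimension.\<close>

lemma vanishing_ideal_psubset_irrelevant_ideal:
  fixes Z :: "('n::finite \<Rightarrow> 'k::field_char_0) set set"
  assumes "Z \<noteq> {}" "Z \<subseteq> proj_space"
  shows "vanishing_ideal Z \<subset> irrelevant_ideal"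
proof -
  obtain p v where p: "p \<in> Z" "p \<in> proj_space" "v \<in> p"
    using assms proj_space_nonempty by blast
  then obtain i where i: "v i \<noteq> 0"
    using proj_space_nonzero by (metis ext)
  have "f \<in> irrelevant_ideal" if "f \<in> vanishing_ideal Z" for f
    using poly_on_line[of v f 0] on_line_vanishing_ideal[OF p(2,1,3) that]
    by (simp add: irrelevant_ideal_def)
  moreover have "Var i \<in> irrelevant_ideal" "Var i \<notin> vanishing_ideal Z"
    using p i by (auto simp: irrelevant_ideal_def vanishing_ideal_def mpoly_eval_Var)
  ultimately show ?thesis by blast
qed

section \<open>Krull dimension of polynomial rings\<close>

text \<open>Gaussian elimination: equation \<open>b0\<close> expresses the unknown \<open>a0\<close>
  through the others, which leaves one equation and one unknown less.\<close>

lemma exists_nontrivial_solution: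
  fixes M :: "'b \<Rightarrow> 'a \<Rightarrow> 'k::field"
  assumes "finite B" "finite A" "card B < card A"
  shows "\<exists>c. (\<exists>a\<in>A. c a \<noteq> 0) \<and> (\<forall>b\<in>B. (\<Sum>a\<in>A. M b a * c a) = 0)"
  using assms
proof (induction B arbitrary: A M rule: finite_induct)
  case empty
  then show ?case by (intro exI[of _ "\<lambda>_. 1"]) (auto simp: card_gt_0_iff)
next
  case (insert b0 B)
  show ?case
  proof (cases "\<forall>a\<in>A. M b0 a = 0")
    case True
    then have "(\<Sum>a\<in>A. M b0 a * c a) = 0" for c
      by (intro sum.neutral) auto
    with insert.IH[of A M] insert.prems insert.hyps show ?thesis by auto
  next
    case False
    then obtain a0 where a0: "a0 \<in> A" "M b0 a0 \<noteq> 0" by blast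
    let ?A = "A - {a0}"
    \<comment> \<open>Row \<open>b\<close> minus the multiple of row \<open>b0\<close> that clears
      column \<open>a0\<close>.\<close>
    define M' where "M' b a = M b a - M b a0 * M b0 a / M b0 a0" for b a
    have "card B < card ?A"
      using insert.prems insert.hyps a0 by simp
    then obtain c' where c': "\<exists>a\<in>?A. c' a \<noteq> 0" "\<forall>b\<in>B. (\<Sum>a\<in>?A. M' b a * c' a) = 0"
      using insert.IH[of ?A M'] insert.prems(1) by blast
    define s where "s = (\<Sum>a\<in>?A. M b0 a * c' a) / M b0 a0"
    define c where "c = c'(a0 := - s)"
    have sum_c: "(\<Sum>a\<in>A. M b a * c a) = (\<Sum>a\<in>?A. M b a * c' a) - M b a0 * s" for b
    proof -
      have "(\<Sum>a\<in>A. M b a * c a) = M b a0 * c a0 + (\<Sum>a\<in>?A. M b a * c a)"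
        using a0 insert.prems by (intro sum.remove) auto
      moreover have "(\<Sum>a\<in>?A. M b a * c a) = (\<Sum>a\<in>?A. M b a * c' a)"
        by (rule sum.cong) (auto simp: c_def)
      ultimately show ?thesis by (simp add: c_def)
    qed
    have "(\<Sum>a\<in>A. M b a * c a) = 0" if "b \<in> insert b0 B" for b
    proof (cases "b = b0")
      case True
      show ?thesis unfolding sum_c True using a0 by (simp add: s_def)
    next
      case False
      have "(\<Sum>a\<in>?A. M' b a * c' a) = (\<Sum>a\<in>?A. M b a * c' a) - M b a0 * s"
        by (simp add: M'_def s_def left_diff_distrib sum_subtractf sum_distrib_left
            sum_divide_distrib mult.assoc)
      with False that c'(2) show ?thesis unfolding sum_c by auto
    qed
    moreover have "\<exists>a\<in>A. c a \<noteq> 0"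
      using c'(1) by (auto simp: c_def)
    ultimately show ?thesis by blast
  qed
qed

section \<open>Counting monomials and algebraic dependence\<close>

lemma coeff_of_Const_mult: "coeff_of (Const c * f) m = c * coeff_of f m"
proof (induction f rule: mpoly_induct)
  case (monom m' d)
  show ?case by (simp add: mult_single lookup_single when_def)
qed (simp add: distrib_left lookup_add)

text \<open>Each exponent is bounded separately, not the total degree: the bound still adds under
  products, and the monomials form a box that is easy to count.\<close>

definition expo_bounded :: "nat \<Rightarrow> ('n, 'k::zero) mpoly \<Rightarrow> bool" where
  "expo_bounded K f \<longleftrightarrow> (\<forall>m\<in>monoms f. \<forall>i. expo m i \<le> K)"

lemma expo_bounded_mult: "expo_bounded K f \<Longrightarrow> expo_bounded L g \<Longrightarrow> expo_bounded (K + L) (f * g)"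
  using keys_mult[of f g] by (fastforce simp: expo_bounded_def lookup_add intro: add_mono)

lemma expo_bounded_one: "expo_bounded 0 1"
  by (simp add: expo_bounded_def)

lemma expo_bounded_power: "expo_bounded K f \<Longrightarrow> expo_bounded (r * K) (f ^ r)"
  by (induction r) (auto simp: expo_bounded_one intro: expo_bounded_mult)

lemma expo_bounded_prod:
  assumes "\<And>x. x \<in> A \<Longrightarrow> expo_bounded (e x) (f x)"
  shows "expo_bounded (\<Sum>x\<in>A. e x) (\<Prod>x\<in>A. f x)"
  using assms
  by (induction A rule: infinite_finite_induct) (auto simp: expo_bounded_one intro: expo_bounded_mult)

lemma expo_bounded_mono: "expo_bounded K f \<Longrightarrow> K \<le> L \<Longrightarrow> expo_bounded L f"
  unfolding expo_bounded_def using le_trans by blast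

lemma ex_expo_bounded:
  fixes f :: "('n::finite, 'k::zero) mpoly"
  shows "\<exists>K. expo_bounded K f"
proof -
  have "finite ((\<lambda>(m, i). expo m i) ` (monoms f \<times> UNIV))" by simp
  then obtain K where "\<forall>x \<in> (\<lambda>(m, i). expo m i) ` (monoms f \<times> UNIV). x \<le> K"
    using finite_nat_set_iff_bounded_le by blast
  then show ?thesis by (auto simp: expo_bounded_def)
qed

lemma card_expo_le:
  fixes K :: nat
  defines "B \<equiv> {m :: 'n::finite \<Rightarrow>\<^sub>0 nat. \<forall>i. expo m i \<le> K}"
  shows "finite B" "card B \<le> (K + 1) ^ CARD('n)"
proof -
  let ?P = "PiE (UNIV :: 'n set) (\<lambda>_. {..K})"
  have inj: "inj_on expo B" by (auto intro: inj_onI poly_mapping_eqI)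
  have sub: "expo ` B \<subseteq> ?P" by (auto simp: B_def)
  have fin: "finite ?P" by (intro finite_PiE) auto
  show "finite B" using finite_imageD[OF finite_subset[OF sub fin] inj] .
  have "card B = card (expo ` B)" by (rule card_image[symmetric, OF inj])
  also have "\<dots> \<le> card ?P" by (rule card_mono[OF fin sub])
  also have "\<dots> = (K + 1) ^ CARD('n)" by (simp add: card_PiE)
  finally show "card B \<le> (K + 1) ^ CARD('n)" .
qed

text \<open>There are more monomials of bounded degree in \<open>n + 1\<close> polynomials than there are monomials
  in \<open>n\<close> variables that can occur in them.\<close>

lemma algebraically_dependent:
  fixes f :: "nat \<Rightarrow> ('n::finite, 'k::field) mpoly"
  defines "n \<equiv> CARD('n)"
  shows "\<exists>E c. finite E \<and> E \<noteq> {} \<and> E \<subseteq> PiE {..n} (\<lambda>_. UNIV) \<and> (\<forall>e\<in>E. c e \<noteq> 0) \<and>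
    (\<Sum>e\<in>E. Const (c e) * (\<Prod>i\<le>n. f i ^ e i)) = 0"
proof -
  have "\<forall>i. \<exists>K. expo_bounded K (f i)"
    using ex_expo_bounded by blast
  then obtain b where b: "\<forall>i. expo_bounded (b i) (f i)"
    using choice[of "\<lambda>i K. expo_bounded K (f i)"] by blast
  define D where "D = (\<Sum>i\<le>n. b i)"
  have D: "expo_bounded D (f i)" if "i \<le> n" for i
    unfolding D_def using that by (intro expo_bounded_mono[OF b[rule_format, of i]] member_le_sum) auto
  \<comment> \<open>With this \<open>N\<close>,
    \<open>K + 1 \<le> (N + 1) * ((n + 1) * D + 1)\<close>, so at most
    \<open>(N + 1) ^ n * N\<close> monomials face \<open>(N + 1) ^ (n + 1)\<close> unknown
    coefficients.\<close>
  define N where "N = ((n + 1) * D + 1) ^ n"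
  define K where "K = (n + 1) * (N * D)"
  define A where "A = PiE {..n} (\<lambda>_. {..N})"
  define B where "B = {m :: 'n \<Rightarrow>\<^sub>0 nat. \<forall>i. expo m i \<le> K}"
  define F where "F e = (\<Prod>i\<le>n. f i ^ e i)" for e
  have F: "expo_bounded K (F e)" if "e \<in> A" for e
  proof -
    have "expo_bounded (\<Sum>i\<le>n. e i * D) (F e)"
      unfolding F_def by (intro expo_bounded_prod expo_bounded_power D) auto
    moreover have "(\<Sum>i\<le>n. e i * D) \<le> (\<Sum>i\<le>n. N * D)"
      using that by (intro sum_mono mult_right_mono) (auto simp: A_def PiE_iff)
    ultimately show ?thesis
      by (intro expo_bounded_mono[of _ _ K]) (simp_all add: K_def)
  qed
  have "card B \<le> (K + 1) ^ n"
    unfolding B_def n_def by (rule card_expo_le)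
  also have "\<dots> \<le> ((N + 1) * ((n + 1) * D + 1)) ^ n"
    by (rule power_mono) (auto simp: K_def algebra_simps)
  also have "\<dots> = (N + 1) ^ n * N"
    by (simp only: power_mult_distrib N_def)
  also have "\<dots> < (N + 1) ^ n * (N + 1)"
    by simp
  also have "\<dots> = card A"
    by (simp add: A_def card_PiE)
  finally have "card B < card A" .
  moreover have "finite A" by (auto simp: A_def intro: finite_PiE)
  moreover have "finite B" unfolding B_def by (rule card_expo_le)
  ultimately obtain c where c: "\<exists>e\<in>A. c e \<noteq> 0" "\<forall>m\<in>B. (\<Sum>e\<in>A. coeff_of (F e) m * c e) = 0"
    using exists_nontrivial_solution[of B A "\<lambda>m e. coeff_of (F e) m"] by blast
  have "(\<Sum>e\<in>A. Const (c e) * F e) = 0"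
  proof (rule poly_mapping_eqI)
    fix m
    have "coeff_of (\<Sum>e\<in>A. Const (c e) * F e) m = (\<Sum>e\<in>A. coeff_of (F e) m * c e)"
      by (simp only: lookup_sum coeff_of_Const_mult mult.commute[of "coeff_of _ _"])
    also have "\<dots> = 0"
    proof (cases "m \<in> B")
      case True
      then show ?thesis using c(2) by blast
    next
      case False
      have "coeff_of (F e) m = 0" if "e \<in> A" for e
      proof (rule ccontr)
        assume "coeff_of (F e) m \<noteq> 0"
        then have "m \<in> monoms (F e)" by (simp add: in_keys_iff)
        then have "m \<in> B" using F[OF that] by (simp add: B_def expo_bounded_def)
        with False show False by blast
      qed
      then show ?thesis by (intro sum.neutral) simp
    qed
    finally show "coeff_of (\<Sum>e\<in>A. Const (c e) * F e) m = coeff_of 0 m" by simp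
  qed
  \<comment> \<open>Zero coefficients are dropped because \<open>prime_chain_length_le\<close>
    inverts the last one that remains.\<close>
  moreover have "(\<Sum>e\<in>{e\<in>A. c e \<noteq> 0}. Const (c e) * F e) = (\<Sum>e\<in>A. Const (c e) * F e)"
    using \<open>finite A\<close> by (intro sum.mono_neutral_left) auto
  ultimately have "(\<Sum>e\<in>{e\<in>A. c e \<noteq> 0}. Const (c e) * F e) = 0"
    by simp
  moreover have "{e\<in>A. c e \<noteq> 0} \<subseteq> PiE {..n} (\<lambda>_. UNIV)"
    unfolding A_def using PiE_mono[of "{..n}" "\<lambda>_. {..N}" "\<lambda>_. UNIV"] by blast
  moreover have "finite {e\<in>A. c e \<noteq> 0}" "{e\<in>A. c e \<noteq> 0} \<noteq> {}" "\<forall>e\<in>{e\<in>A. c e \<noteq> 0}. c e \<noteq> 0"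
    using c(1) \<open>finite A\<close> by auto
  ultimately show ?thesis
    unfolding F_def by blast
qed

text \<open>The argument of Coquand and Lombardi: pick \<open>x\<^sub>i \<in> Q\<^sub>i\<^sub>+\<^sub>1 - Q\<^sub>i\<close> and look at the
  lexicographically least monomial of an algebraic relation between the \<open>x\<^sub>i\<close>. Dividing by the
  lowest power of \<open>x\<^sub>i\<close> and reducing modulo \<open>x\<^sub>i\<close> moves the relation from \<open>Q\<^sub>i\<close> to \<open>Q\<^sub>i\<^sub>+\<^sub>1\<close>.\<close>

lemma relation_step:
  fixes x :: "nat \<Rightarrow> ('n::finite, 'k::field) mpoly"
  assumes Q: "prime_ideal Q" "prime_ideal Q'" "Q \<subseteq> Q'" "x i \<notin> Q" "x i \<in> Q'" "i \<le> n"
    and E: "finite E" "E \<noteq> {}"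
    and rel: "(\<Sum>e\<in>E. Const (c e) * (\<Prod>l\<in>{i..n}. x l ^ e l)) \<in> Q"
  shows "\<exists>E'\<subseteq>E. E' \<noteq> {} \<and> (\<forall>e\<in>E'. \<forall>e'\<in>E'. e i = e' i) \<and>
    (\<Sum>e\<in>E'. Const (c e) * (\<Prod>l\<in>{Suc i..n}. x l ^ e l)) \<in> Q'"
proof -
  define m where "m = Min ((\<lambda>e. e i) ` E)"
  define E' where "E' = {e \<in> E. e i = m}"
  define G where "G e = Const (c e) * (\<Prod>l\<in>{Suc i..n}. x l ^ e l)" for e
  have "m \<in> (\<lambda>e. e i) ` E" unfolding m_def using E by (intro Min_in) auto
  then have "E' \<noteq> {}" by (auto simp: E'_def)
  have le: "m \<le> e i" if "e \<in> E" for e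
    unfolding m_def using E that by (intro Min_le) auto
  have split: "Const (c e) * (\<Prod>l\<in>{i..n}. x l ^ e l) = x i ^ e i * G e" for e
    using \<open>i \<le> n\<close> by (simp add: G_def atLeastAtMost_insertL[symmetric] ac_simps)
  \<comment> \<open>The terms with a higher power of \<open>x i\<close>, divided by
    \<open>x i ^ Suc m\<close>; the subtraction is exact because \<open>e i > m\<close> outside
    \<open>E'\<close>.\<close>
  define R where "R = (\<Sum>e\<in>E - E'. x i ^ (e i - Suc m) * G e)"
  have "(\<Sum>e\<in>E. x i ^ e i * G e) = (\<Sum>e\<in>E'. x i ^ e i * G e) + (\<Sum>e\<in>E - E'. x i ^ e i * G e)"
    using E by (subst sum.subset_diff[of E' E]) (auto simp: E'_def add.commute)
  also have "(\<Sum>e\<in>E'. x i ^ e i * G e) = x i ^ m * (\<Sum>e\<in>E'. G e)"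
    unfolding sum_distrib_left by (rule sum.cong) (auto simp: E'_def)
  also have "(\<Sum>e\<in>E - E'. x i ^ e i * G e) = x i ^ m * (x i * R)"
    unfolding R_def sum_distrib_left
  proof (rule sum.cong)
    fix e assume "e \<in> E - E'"
    then have "m < e i" using le[of e] by (auto simp: E'_def order.strict_iff_order)
    then have "x i ^ e i = x i ^ m * (x i * x i ^ (e i - Suc m))"
      by (simp add: power_Suc[symmetric] power_add[symmetric] del: power_Suc)
    then show "x i ^ e i * G e = x i ^ m * (x i * (x i ^ (e i - Suc m) * G e))"
      by (simp add: ac_simps)
  qed simp
  finally have "x i ^ m * ((\<Sum>e\<in>E'. G e) + x i * R) \<in> Q"
    using rel by (simp add: split distrib_left)
  \<comment> \<open>\<open>Q\<close> is prime and does not contain \<open>x i\<close>, so the factor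
    \<open>x i ^ m\<close> cancels.\<close>
  then have "(\<Sum>e\<in>E'. G e) + x i * R \<in> Q'"
    using Q prime_ideal_power prime_idealD(6) by blast
  moreover have "x i * R \<in> Q'" using Q by (intro prime_idealD(5)) auto
  ultimately have "(\<Sum>e\<in>E'. G e) \<in> Q'"
    using prime_ideal_diff[OF Q(2)] by fastforce
  then show ?thesis
    using \<open>E' \<noteq> {}\<close> by (intro exI[of _ E']) (auto simp: E'_def G_def)
qed

text \<open>A longer chain yields \<open>n + 1\<close> elements \<open>x i\<close>, hence an
  algebraic relation. Each step up the chain uses up one of them, until a nonzero constant remains
  in \<open>Q (Suc n)\<close>.\<close>

theorem prime_chain_length_le:
  fixes Q :: "nat \<Rightarrow> ('n::finite, 'k::field) mpoly set"
  assumes prime: "\<And>i. i \<le> k \<Longrightarrow> prime_ideal (Q i)" and chain: "\<And>i. i < k \<Longrightarrow> Q i \<subset> Q (Suc i)"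
  shows "k \<le> CARD('n)"
proof (rule ccontr)
  define n where "n = CARD('n)"
  assume "\<not> k \<le> CARD('n)"
  then have k: "n < k" by (simp add: n_def)
  have "\<forall>i. \<exists>x. i \<le> n \<longrightarrow> x \<in> Q (Suc i) \<and> x \<notin> Q i"
    using chain k by (meson le_less_trans psubset_imp_ex_mem DiffD1 DiffD2)
  then obtain x where x: "x i \<in> Q (Suc i)" "x i \<notin> Q i" if "i \<le> n" for i
    by metis
  obtain E0 c where E0: "finite E0" "E0 \<noteq> {}" "E0 \<subseteq> PiE {..n} (\<lambda>_. UNIV)" "\<forall>e\<in>E0. c e \<noteq> 0"
    "(\<Sum>e\<in>E0. Const (c e) * (\<Prod>i\<le>n. x i ^ e i)) = 0"
    using algebraically_dependent[of x] unfolding n_def by blast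
  have "\<exists>E\<subseteq>E0. E \<noteq> {} \<and> (\<forall>e\<in>E. \<forall>e'\<in>E. \<forall>l<i. e l = e' l) \<and>
    (\<Sum>e\<in>E. Const (c e) * (\<Prod>l\<in>{i..n}. x l ^ e l)) \<in> Q i" if "i \<le> Suc n" for i
    using that
  proof (induction i)
    case 0
    have "(\<Sum>e\<in>E0. Const (c e) * (\<Prod>l\<in>{0..n}. x l ^ e l)) \<in> Q 0"
      using E0(5) prime_idealD(1)[OF prime[of 0]] by (simp add: atLeast0AtMost)
    then show ?case using E0(2) by (intro exI[of _ E0]) simp
  next
    case (Suc i)
    then obtain E where E: "E \<subseteq> E0" "E \<noteq> {}" "\<forall>e\<in>E. \<forall>e'\<in>E. \<forall>l<i. e l = e' l"
      "(\<Sum>e\<in>E. Const (c e) * (\<Prod>l\<in>{i..n}. x l ^ e l)) \<in> Q i" by auto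
    have i: "i \<le> n" "i < k" using Suc.prems k by auto
    obtain E' where E': "E' \<subseteq> E" "E' \<noteq> {}" "\<forall>e\<in>E'. \<forall>e'\<in>E'. e i = e' i"
      "(\<Sum>e\<in>E'. Const (c e) * (\<Prod>l\<in>{Suc i..n}. x l ^ e l)) \<in> Q (Suc i)"
      using relation_step[of "Q i" "Q (Suc i)" x i n E c] prime[of i] prime[of "Suc i"] x[of i]
        chain[of i] i E finite_subset[OF E(1) E0(1)] by auto
    have "e l = e' l" if "e \<in> E'" "e' \<in> E'" "l < Suc i" for e e' l
      using that E(3) E'(1,3) less_antisym by blast
    then show ?case using E(1) E' by (intro exI[of _ E']) auto
  qed
  from this[of "Suc n"] obtain E where E: "E \<subseteq> E0" "E \<noteq> {}"
    "\<forall>e\<in>E. \<forall>e'\<in>E. \<forall>l<Suc n. e l = e' l" "(\<Sum>e\<in>E. Const (c e)) \<in> Q (Suc n)"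
    by auto
  obtain e where e: "e \<in> E" using E(2) by blast
  \<comment> \<open>The exponent vectors in \<open>E\<close> agree on \<open>{..n}\<close> and are
    extensional, so only one is left.\<close>
  have "E = {e}"
  proof -
    have "e' = e" if "e' \<in> E" for e'
    proof (rule PiE_ext)
      show "e' \<in> PiE {..n} (\<lambda>_. UNIV)" "e \<in> PiE {..n} (\<lambda>_. UNIV)"
        using that e E(1) E0(3) by blast+
      show "e' l = e l" if "l \<in> {..n}" for l
        using \<open>e' \<in> E\<close> e E(3) that by (simp add: less_Suc_eq_le)
    qed
    then show ?thesis using e by blast
  qed
  then have "Const (c e) \<in> Q (Suc n)" using E(4) by simp
  then have "Const (inverse (c e)) * Const (c e) \<in> Q (Suc n)"
    using prime[of "Suc n"] k by (intro prime_idealD(4)) auto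
  moreover have "Const (inverse (c e)) * Const (c e) = (1 :: ('n, 'k) mpoly)"
    using E0(4) E(1) e by (auto simp: mult_single)
  ultimately show False
    using prime_idealD(2)[OF prime[of "Suc n"]] k by simp
qed

section \<open>Unique factorization\<close>

text \<open>The subring \<open>K[x_i : i in I]\<close>, kept inside the ring in all
  variables.\<close>

definition polys_in :: "'n set \<Rightarrow> ('n, 'k::zero) mpoly set" where
  "polys_in I = {f. \<forall>m\<in>monoms f. \<forall>i. i \<notin> I \<longrightarrow> expo m i = 0}"

lemma polys_in_UNIV [simp]: "f \<in> polys_in UNIV"
  by (simp add: polys_in_def)

lemma polys_in_mono: "f \<in> polys_in I \<Longrightarrow> I \<subseteq> J \<Longrightarrow> f \<in> polys_in J"
  by (auto simp: polys_in_def)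

lemma polys_in_zero [simp]: "0 \<in> polys_in I"
  by (simp add: polys_in_def)

lemma polys_in_Const [simp]: "Const c \<in> polys_in I"
  by (simp add: polys_in_def)

lemma polys_in_one [simp]: "1 \<in> polys_in I"
  by (simp add: polys_in_def)

lemma polys_in_Var: "i \<in> I \<Longrightarrow> Var i \<in> polys_in I"
  by (auto simp: polys_in_def Var_def lookup_single when_def)

lemma polys_in_add: "f \<in> polys_in I \<Longrightarrow> g \<in> polys_in I \<Longrightarrow> f + g \<in> polys_in I"
  using keys_add[of f g] by (auto simp: polys_in_def)

lemma polys_in_mult: "f \<in> polys_in I \<Longrightarrow> g \<in> polys_in I \<Longrightarrow> f * g \<in> polys_in I"
  using keys_mult[of f g] by (fastforce simp: polys_in_def lookup_add)

lemma polys_in_uminus: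
  fixes f :: "('n, 'k::ab_group_add) mpoly"
  shows "f \<in> polys_in I \<Longrightarrow> - f \<in> polys_in I"
  by (auto simp: polys_in_def in_keys_iff)

lemma polys_in_diff:
  fixes f g :: "('n, 'k::ab_group_add) mpoly"
  shows "f \<in> polys_in I \<Longrightarrow> g \<in> polys_in I \<Longrightarrow> f - g \<in> polys_in I"
  using polys_in_add[of f I "- g"] polys_in_uminus[of g I] by simp

lemma polys_in_sum: "(\<And>x. x \<in> A \<Longrightarrow> f x \<in> polys_in I) \<Longrightarrow> (\<Sum>x\<in>A. f x) \<in> polys_in I"
  by (induction A rule: infinite_finite_induct) (auto intro: polys_in_add)

lemma polys_in_prod: "(\<And>x. x \<in> A \<Longrightarrow> f x \<in> polys_in I) \<Longrightarrow> (\<Prod>x\<in>A. f x) \<in> polys_in I"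
  by (induction A rule: infinite_finite_induct) (auto intro: polys_in_mult)

lemma polys_in_power: "f \<in> polys_in I \<Longrightarrow> f ^ k \<in> polys_in I"
  by (induction k) (auto intro: polys_in_mult)

lemma polys_in_empty:
  assumes "f \<in> polys_in {}"
  shows "f = Const (coeff_of f 0)"
proof (rule poly_mapping_eqI)
  fix m
  have "m = 0" if "m \<in> monoms f"
    using assms that by (intro poly_mapping_eqI) (auto simp: polys_in_def)
  then show "coeff_of f m = coeff_of (Const (coeff_of f 0)) m"
    by (cases "m = 0") (auto simp: lookup_single when_def in_keys_iff)
qed

text \<open>The polynomial \<open>f\<close> as a univariate polynomial in the variable \<open>j\<close>.\<close>

definition wrt :: "'n::finite \<Rightarrow> ('n, 'k::comm_semiring_1) mpoly \<Rightarrow> ('n, 'k) mpoly poly" where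
  "wrt j = eval_hom (\<lambda>c. monom (Const c) 0) (\<lambda>i. if i = j then monom 1 1 else monom (Var i) 0)"

lemma coeff_hom_monom_Const: "coeff_hom (\<lambda>c. monom (Const c) 0)"
  by unfold_locales (simp_all add: monom_0 mult_monom add_monom single_add mult_single mult.commute)

interpretation wrt: coeff_hom "\<lambda>c. monom (Const c) 0"
  by (rule coeff_hom_monom_Const)

lemma wrt_add: "wrt j (f + g) = wrt j f + wrt j g"
  by (simp add: wrt_def wrt.eval_hom_add)

lemma wrt_mult: "wrt j (f * g) = wrt j f * wrt j g"
  by (simp add: wrt_def wrt.eval_hom_mult)

lemma wrt_zero [simp]: "wrt j 0 = 0"
  by (simp add: wrt_def)

lemma wrt_diff:
  fixes f g :: "('n::finite, 'k::comm_ring_1) mpoly"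
  shows "wrt j (f - g) = wrt j f - wrt j g"
  using wrt_add[of j "f - g" g] by simp

lemma wrt_Var: "wrt j (Var j) = monom 1 1"
  by (simp add: wrt_def wrt.eval_hom_Var)

lemma wrt_power: "wrt j (f ^ k) = wrt j f ^ k"
  by (simp add: wrt_def wrt.eval_hom_power)

lemma wrt_monom:
  fixes m :: "'n::finite \<Rightarrow>\<^sub>0 nat" and c :: "'k::comm_semiring_1"
  shows "wrt j (Poly_Mapping.single m c) =
    monom (Const c * (\<Prod>i\<in>UNIV - {j}. Var i ^ expo m i)) (expo m j)"
proof -
  have prod: "(\<Prod>i\<in>A. monom (g i) 0) = (monom (\<Prod>i\<in>A. g i) 0 :: ('n, 'k) mpoly poly)"
    for g and A :: "'n set"
    by (induction A rule: infinite_finite_induct) (simp_all add: mult_monom monom_0 mult.commute)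
  have "(\<Prod>i\<in>UNIV. (if i = j then monom 1 1 else monom (Var i) 0) ^ expo m i) =
      monom 1 1 ^ expo m j * (\<Prod>i\<in>UNIV - {j}. (if i = j then monom 1 1 else monom (Var i :: ('n, 'k) mpoly) 0) ^ expo m i)"
    by (subst prod.remove[of _ j]) auto
  also have "(\<Prod>i\<in>UNIV - {j}. (if i = j then monom 1 1 else monom (Var i :: ('n, 'k) mpoly) 0) ^ expo m i) =
      (\<Prod>i\<in>UNIV - {j}. monom (Var i ^ expo m i) 0)"
    by (rule prod.cong) (auto simp: monom_power)
  finally have "(\<Prod>i\<in>UNIV. (if i = j then monom 1 1 else monom (Var i) 0) ^ expo m i) =
      (monom (\<Prod>i\<in>UNIV - {j}. Var i ^ expo m i) (expo m j) :: ('n, 'k) mpoly poly)"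
    by (simp add: prod monom_power mult_monom)
  then show ?thesis
    by (simp only: wrt_def wrt.eval_hom_monom mult_monom add_0)
qed

lemma monom_split_Var:
  fixes m :: "'n::finite \<Rightarrow>\<^sub>0 nat" and c :: "'k::comm_semiring_1"
  shows "Poly_Mapping.single m c =
    Const c * (\<Prod>i\<in>UNIV - {j}. Var i ^ expo m i) * Var j ^ expo m j"
proof -
  have "(\<Prod>i\<in>UNIV. Var i ^ expo m i :: ('n, 'k) mpoly) =
      Var j ^ expo m j * (\<Prod>i\<in>UNIV - {j}. Var i ^ expo m i)"
    by (rule prod.remove) auto
  then show ?thesis
    by (simp only: monom_eq_Const_times[of m c] ac_simps)
qed

lemma poly_wrt_Var: "poly (wrt j f) (Var j) = f"
proof (induction f rule: mpoly_induct)
  case (monom m c)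
  show ?case
    unfolding wrt_monom poly_monom by (rule monom_split_Var[symmetric])
qed (simp add: wrt_add)

lemma wrt_eq_0_iff [simp]: "wrt j f = 0 \<longleftrightarrow> f = 0"
  by (metis poly_0 poly_wrt_Var wrt_zero)

lemma wrt_sum_monoms: "wrt j f = (\<Sum>m\<in>monoms f. wrt j (Poly_Mapping.single m (coeff_of f m)))"
proof -
  have "wrt j (\<Sum>m\<in>monoms f. Poly_Mapping.single m (coeff_of f m)) =
      (\<Sum>m\<in>monoms f. wrt j (Poly_Mapping.single m (coeff_of f m)))"
    unfolding wrt_def by (rule wrt.eval_hom_sum)
  then show ?thesis by (simp only: mpoly_sum_monoms[of f, symmetric])
qed

lemma coeff_wrt_in:
  assumes "f \<in> polys_in I"
  shows "coeff (wrt j f) k \<in> polys_in (I - {j})"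
proof -
  have "coeff (wrt j (Poly_Mapping.single m c)) k \<in> polys_in (I - {j})" if "m \<in> monoms f" for m c
  proof -
    have "Var i ^ expo m i \<in> polys_in (I - {j})" if "i \<noteq> j" for i
    proof (cases "i \<in> I")
      case True
      then show ?thesis using that by (intro polys_in_power polys_in_Var) auto
    next
      case False
      then show ?thesis using assms \<open>m \<in> monoms f\<close> by (simp add: polys_in_def)
    qed
    then show ?thesis
      unfolding wrt_monom coeff_monom by (auto intro!: polys_in_mult polys_in_prod)
  qed
  then show ?thesis
    unfolding wrt_sum_monoms[of j f] coeff_sum by (intro polys_in_sum)
qed

lemma sum_const_poly: "(\<Sum>x\<in>A. [:g x:]) = [:\<Sum>x\<in>A. g x:]"
  by (induction A rule: infinite_finite_induct) simp_all

lemma wrt_free: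
  assumes "f \<in> polys_in I" "j \<notin> I"
  shows "wrt j f = [:f:]"
proof -
  have "wrt j (Poly_Mapping.single m c) = [:Poly_Mapping.single m c:]" if "m \<in> monoms f" for m c
  proof -
    have m: "expo m j = 0" using assms that by (auto simp: polys_in_def)
    show ?thesis
      using monom_split_Var[of m c j] unfolding wrt_monom m by (simp add: monom_0)
  qed
  then have "wrt j f = (\<Sum>m\<in>monoms f. [:Poly_Mapping.single m (coeff_of f m):])"
    unfolding wrt_sum_monoms[of j f] by (intro sum.cong) auto
  also have "\<dots> = [:\<Sum>m\<in>monoms f. Poly_Mapping.single m (coeff_of f m):]"
    by (rule sum_const_poly)
  finally show ?thesis by (simp only: mpoly_sum_monoms[of f, symmetric])
qed

text \<open>The assumption on leading coefficients replaces the absence of zero divisors, which is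
  itself derived from this lemma by induction on the variables.\<close>

lemma degree_lead_coeff_mult:
  fixes p q :: "'r::comm_semiring_1 poly"
  assumes "lead_coeff p * lead_coeff q \<noteq> 0"
  shows "degree (p * q) = degree p + degree q" "lead_coeff (p * q) = lead_coeff p * lead_coeff q"
proof -
  have "coeff (p * q) (degree p + degree q) = lead_coeff p * lead_coeff q"
    by (rule coeff_mult_degree_sum)
  with assms show "degree (p * q) = degree p + degree q"
    by (metis degree_mult_le le_degree order_antisym)
  then show "lead_coeff (p * q) = lead_coeff p * lead_coeff q"
    by (simp add: coeff_mult_degree_sum)
qed

text \<open>The leading coefficients with respect to \<open>x_j\<close> lie in the subring with one
  variable less, where the induction hypothesis applies.\<close>

lemma polys_in_mult_nonzero:
  fixes f g :: "('n::finite, 'k::idom) mpoly"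
  assumes "finite I" "f \<in> polys_in I" "g \<in> polys_in I" "f \<noteq> 0" "g \<noteq> 0"
  shows "f * g \<noteq> 0"
  using assms
proof (induction I arbitrary: f g rule: finite_induct)
  case empty
  then have "f = Const (coeff_of f 0)" "g = Const (coeff_of g 0)"
    by (simp_all add: polys_in_empty[symmetric])
  then obtain a b where "f = Const a" "g = Const b" by blast
  with empty have "coeff_of (f * g) 0 \<noteq> 0" by (auto simp: mult_single)
  then show ?case by auto
next
  case (insert j I)
  have "lead_coeff (wrt j f) * lead_coeff (wrt j g) \<noteq> 0"
    using insert.hyps insert.prems coeff_wrt_in[of _ "insert j I" j]
    by (intro insert.IH) auto
  then have "wrt j (f * g) \<noteq> 0"
    unfolding wrt_mult using degree_lead_coeff_mult(2) by force
  then show ?case by simp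
qed

lemma mpoly_mult_eq_0_iff [simp]:
  fixes f g :: "('n::finite, 'k::idom) mpoly"
  shows "f * g = 0 \<longleftrightarrow> f = 0 \<or> g = 0"
  using polys_in_mult_nonzero[of UNIV f g] by auto

lemma mpoly_mult_left_cancel:
  fixes f g c :: "('n::finite, 'k::idom) mpoly"
  assumes "c * f = c * g" "c \<noteq> 0"
  shows "f = g"
proof -
  have "c * (f - g) = 0" using assms by (simp add: right_diff_distrib)
  then show ?thesis using assms by simp
qed

section \<open>Degrees, units and divisibility\<close>

lemma degree_mult_mpoly:
  fixes p q :: "('n::finite, 'k::idom) mpoly poly"
  assumes "p \<noteq> 0" "q \<noteq> 0"
  shows "degree (p * q) = degree p + degree q"
  using assms by (intro degree_lead_coeff_mult) simp

abbreviation deg_wrt :: "'n::finite \<Rightarrow> ('n, 'k::comm_semiring_1) mpoly \<Rightarrow> nat" where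
  "deg_wrt j f \<equiv> degree (wrt j f)"

abbreviation tdeg :: "('n::finite, 'k::comm_semiring_1) mpoly \<Rightarrow> nat" where
  "tdeg f \<equiv> degree (grading f)"

lemma deg_wrt_mult:
  fixes f g :: "('n::finite, 'k::idom) mpoly"
  shows "f \<noteq> 0 \<Longrightarrow> g \<noteq> 0 \<Longrightarrow> deg_wrt j (f * g) = deg_wrt j f + deg_wrt j g"
  unfolding wrt_mult by (rule degree_mult_mpoly) simp_all

lemma grading_eq_0_iff: "grading f = 0 \<longleftrightarrow> f = 0"
  by (metis grading.eval_hom_zero grading_def poly_0 poly_grading_1)

lemma tdeg_mult:
  fixes f g :: "('n::finite, 'k::idom) mpoly"
  assumes "f \<noteq> 0" "g \<noteq> 0"
  shows "tdeg (f * g) = tdeg f + tdeg g"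
proof -
  have "grading (f * g) = grading f * grading g"
    by (simp add: grading_def grading.eval_hom_mult)
  then show ?thesis
    using assms by (simp add: degree_mult_mpoly grading_eq_0_iff)
qed

lemma tdeg_eq_0D:
  assumes "tdeg f = 0"
  shows "\<exists>c. f = Const c"
proof -
  have "f = hcomp 0 f"
    using sum_hcomp[of f] assms by (metis atMost_0 empty_iff finite.emptyI sum.empty sum.insert add.right_neutral)
  then have "homogeneous 0 f" by (metis homogeneous_hcomp)
  then have "f \<in> polys_in {}" by (auto simp: homogeneous_def polys_in_def)
  then show ?thesis using polys_in_empty by blast
qed

lemma tdeg_Const: "tdeg (Const c) = 0"
  by (simp add: grading_monom monom_0)

lemma unit_iff_tdeg:
  fixes f :: "('n::finite, 'k::field) mpoly"
  assumes "f \<noteq> 0"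
  shows "f dvd 1 \<longleftrightarrow> tdeg f = 0"
proof
  assume "f dvd 1"
  then obtain g where g: "1 = f * g" by (auto elim: dvdE)
  then have "g \<noteq> 0" by auto
  then have "tdeg f + tdeg g = tdeg (1 :: ('n, 'k) mpoly)"
    using g assms tdeg_mult by metis
  moreover have "tdeg (1 :: ('n, 'k) mpoly) = 0"
    by (metis single_one tdeg_Const)
  ultimately show "tdeg f = 0" by simp
next
  assume "tdeg f = 0"
  then obtain c where c: "f = Const c" using tdeg_eq_0D by blast
  then have "c \<noteq> 0" using assms by auto
  then have "f * Const (inverse c) = 1" by (simp add: c mult_single)
  then show "f dvd 1" by (metis dvd_triv_left)
qed

lemma polys_in_iff_deg_wrt: "f \<in> polys_in I \<longleftrightarrow> (\<forall>i. i \<notin> I \<longrightarrow> deg_wrt i f = 0)"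
proof
  assume "f \<in> polys_in I"
  then show "\<forall>i. i \<notin> I \<longrightarrow> deg_wrt i f = 0"
    by (simp add: wrt_free)
next
  assume deg: "\<forall>i. i \<notin> I \<longrightarrow> deg_wrt i f = 0"
  have "f \<in> polys_in (UNIV - {i})" if "i \<notin> I" for i
  proof -
    have "deg_wrt i f = 0"
      using deg that by blast
    then obtain c where c: "wrt i f = [:c:]"
      by (rule degree_eq_zeroE)
    then have "f = coeff (wrt i f) 0"
      using poly_wrt_Var[of i f] by simp
    then show ?thesis using coeff_wrt_in[of f UNIV i 0] by simp
  qed
  then show "f \<in> polys_in I"
    by (auto simp: polys_in_def)
qed

text \<open>Degrees in each variable add up, so a factor of a nonzero product contains no new
  variable.\<close>

lemma polys_in_factor:
  fixes f g :: "('n::finite, 'k::idom) mpoly"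
  assumes "f * g \<in> polys_in I" "f * g \<noteq> 0"
  shows "f \<in> polys_in I" "g \<in> polys_in I"
  using assms by (auto simp: polys_in_iff_deg_wrt deg_wrt_mult)

lemma dvd_iff_dvd_coeffs:
  fixes p f :: "('n::finite, 'k::comm_ring_1) mpoly"
  assumes "p \<in> polys_in I" "j \<notin> I"
  shows "p dvd f \<longleftrightarrow> (\<forall>k. p dvd coeff (wrt j f) k)"
proof
  assume "p dvd f"
  then obtain g where "f = p * g" by (auto elim: dvdE)
  then have "wrt j f = smult p (wrt j g)"
    using wrt_free[OF assms] by (simp add: wrt_mult)
  then show "\<forall>k. p dvd coeff (wrt j f) k" by simp
next
  assume "\<forall>k. p dvd coeff (wrt j f) k"
  then have "p dvd (\<Sum>k\<le>deg_wrt j f. coeff (wrt j f) k * Var j ^ k)"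
    by (intro dvd_sum dvd_mult2) auto
  then show "p dvd f"
    using poly_wrt_Var[of j f] by (simp add: poly_altdef)
qed

lemma exists_irreducible_factor:
  fixes f :: "('n::finite, 'k::field) mpoly"
  assumes "f \<noteq> 0" "\<not> f dvd 1"
  shows "\<exists>p. irreducible p \<and> p dvd f"
  using assms
proof (induction "tdeg f" arbitrary: f rule: less_induct)
  case less
  show ?case
  proof (cases "irreducible f")
    case False
    then obtain a b where ab: "f = a * b" "\<not> a dvd 1" "\<not> b dvd 1"
      using less.prems by (auto simp: irreducible_def)
    then have "a \<noteq> 0" "b \<noteq> 0" using less.prems by auto
    then have "tdeg a < tdeg f"
      using ab tdeg_mult[of a b] unit_iff_tdeg[of b] by simp
    with less.hyps[of a] \<open>a \<noteq> 0\<close> ab show ?thesis by auto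
  qed auto
qed

text \<open>The coefficients do not form a field, so each division step multiplies \<open>f\<close>
  by the leading coefficient of \<open>g\<close>; \<open>c\<close> collects these factors.\<close>

lemma pseudo_division:
  fixes f g :: "('n::finite, 'k::idom) mpoly"
  assumes "j \<notin> I" "g \<noteq> 0" "f \<in> polys_in (insert j I)" "g \<in> polys_in (insert j I)"
  shows "\<exists>c q r. c \<in> polys_in I \<and> c \<noteq> 0 \<and> q \<in> polys_in (insert j I) \<and> r \<in> polys_in (insert j I) \<and>
    c * f = q * g + r \<and> (r = 0 \<or> deg_wrt j r < deg_wrt j g)"
  using assms(3)
\<comment> \<open>The measure separates zero from polynomials of degree zero in \<open>x_j\<close>,
  so that reaching zero counts as progress.\<close>
proof (induction "if f = 0 then 0 else Suc (deg_wrt j f)" arbitrary: f rule: less_induct)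
  case less
  let ?A = "polys_in (insert j I) :: ('n, 'k) mpoly set"
  have lc: "coeff (wrt j x) k \<in> polys_in I" if "x \<in> ?A" for x k
    using coeff_wrt_in[OF that, of j k] assms(1) by simp
  have sub: "x \<in> ?A" if "x \<in> polys_in I" for x
    using that polys_in_mono by blast
  show ?case
  proof (cases "f = 0 \<or> deg_wrt j f < deg_wrt j g")
    case True
    then show ?thesis
      using less.prems by (intro exI[of _ 1] exI[of _ 0] exI[of _ f]) auto
  next
    case False
    define a where "a = lead_coeff (wrt j g)"
    define b where "b = lead_coeff (wrt j f)"
    define d where "d = deg_wrt j f - deg_wrt j g"
    have ab: "a \<in> polys_in I" "b \<in> polys_in I" "a \<noteq> 0"
      using lc assms less.prems by (auto simp: a_def b_def)
    define f1 where "f1 = a * f - b * Var j ^ d * g"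
    have f1A: "f1 \<in> ?A"
      unfolding f1_def using ab sub less.prems assms
      by (intro polys_in_diff polys_in_mult polys_in_power polys_in_Var) auto
    have wrt_f1: "wrt j f1 = smult a (wrt j f) - smult b (monom 1 d * wrt j g)"
      unfolding f1_def using wrt_free[OF ab(1) assms(1)] wrt_free[OF ab(2) assms(1)]
      by (simp add: wrt_diff wrt_mult wrt_power wrt_Var monom_power)
    have "f1 = 0 \<or> deg_wrt j f1 < deg_wrt j f"
    proof (rule ccontr)
      assume neg: "\<not> ?thesis"
      have "degree (monom 1 d * wrt j g) \<le> d + deg_wrt j g"
        using degree_mult_le[of "monom 1 d" "wrt j g"] degree_monom_le[of "1::('n,'k) mpoly" d] by linarith
      then have "degree (smult b (monom 1 d * wrt j g)) \<le> deg_wrt j f"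
        using False degree_smult_le[of b "monom 1 d * wrt j g"] by (simp add: d_def)
      then have "deg_wrt j f1 \<le> deg_wrt j f"
        unfolding wrt_f1 by (intro degree_diff_le degree_smult_le)
      then have "deg_wrt j f1 = deg_wrt j f" using neg by simp
      moreover have "coeff (monom 1 d * wrt j g) (deg_wrt j f) = a"
        using False by (simp add: coeff_monom_mult a_def d_def)
      then have "coeff (wrt j f1) (deg_wrt j f) = 0"
        by (simp add: wrt_f1 b_def mult.commute)
      ultimately show False using neg leading_coeff_0_iff[of "wrt j f1"] by simp
    qed
    then have "(if f1 = 0 then 0 else Suc (deg_wrt j f1)) < (if f = 0 then 0 else Suc (deg_wrt j f))"
      using False by auto
    from less.hyps[OF this f1A] obtain c q r where cqr: "c \<in> polys_in I" "c \<noteq> 0" "q \<in> ?A" "r \<in> ?A"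
      "c * f1 = q * g + r" "r = 0 \<or> deg_wrt j r < deg_wrt j g" by blast
    have "(c * a) * f = (q + c * b * Var j ^ d) * g + r"
      using cqr(5) by (simp add: f1_def algebra_simps)
    moreover have "q + c * b * Var j ^ d \<in> ?A"
      using cqr ab sub by (intro polys_in_add polys_in_mult polys_in_power polys_in_Var) auto
    ultimately show ?thesis
      using cqr ab by (intro exI[of _ "c * a"] exI[of _ "q + c * b * Var j ^ d"] exI[of _ r])
        (auto intro: polys_in_mult)
  qed
qed

text \<open>Divisibility is that of the full ring; only the two factors are confined to the
  subring.\<close>

definition prime_in :: "'n set \<Rightarrow> ('n::finite, 'k::comm_semiring_1) mpoly \<Rightarrow> bool" where
  "prime_in I p \<longleftrightarrow> (\<forall>a\<in>polys_in I. \<forall>b\<in>polys_in I. p dvd a * b \<longrightarrow> p dvd a \<or> p dvd b)"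

text \<open>As for products of primitive polynomials: \<open>r\<close> and \<open>s\<close> mark the
  first coefficients of \<open>a\<close> and \<open>b\<close> that \<open>p\<close> does not divide,
  and in the coefficient of \<open>a * b\<close> at \<open>r + s\<close> all other terms are
  divisible by \<open>p\<close>.\<close>

lemma prime_in_insert:
  fixes p :: "('n::finite, 'k::idom) mpoly"
  assumes "prime_in I p" "p \<in> polys_in I" "j \<notin> I"
  shows "prime_in (insert j I) p"
  unfolding prime_in_def
proof (intro ballI impI, rule ccontr)
  fix a b :: "('n, 'k) mpoly"
  assume ab: "a \<in> polys_in (insert j I)" "b \<in> polys_in (insert j I)" "p dvd a * b"
    and "\<not> (p dvd a \<or> p dvd b)"
  note coeffs = dvd_iff_dvd_coeffs[OF assms(2,3)]
  have lc: "coeff (wrt j x) k \<in> polys_in I" if "x \<in> polys_in (insert j I)" for x k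
    using coeff_wrt_in[OF that, of j k] assms(3) by simp
  define r where "r = (LEAST k. \<not> p dvd coeff (wrt j a) k)"
  define s where "s = (LEAST k. \<not> p dvd coeff (wrt j b) k)"
  have r: "\<not> p dvd coeff (wrt j a) r"
    unfolding r_def by (rule LeastI_ex) (use \<open>\<not> (p dvd a \<or> p dvd b)\<close> coeffs in blast)
  have s: "\<not> p dvd coeff (wrt j b) s"
    unfolding s_def by (rule LeastI_ex) (use \<open>\<not> (p dvd a \<or> p dvd b)\<close> coeffs in blast)
  have less_r: "p dvd coeff (wrt j a) k" if "k < r" for k
    using that not_less_Least unfolding r_def by blast
  have less_s: "p dvd coeff (wrt j b) k" if "k < s" for k
    using that not_less_Least unfolding s_def by blast
  have "coeff (wrt j (a * b)) (r + s) =
      (\<Sum>i\<le>r + s. coeff (wrt j a) i * coeff (wrt j b) (r + s - i))"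
    by (simp add: wrt_mult coeff_mult)
  also have "\<dots> = coeff (wrt j a) r * coeff (wrt j b) s +
      (\<Sum>i\<in>{..r + s} - {r}. coeff (wrt j a) i * coeff (wrt j b) (r + s - i))"
    by (subst sum.remove[of _ r]) auto
  finally have eq: "coeff (wrt j (a * b)) (r + s) = coeff (wrt j a) r * coeff (wrt j b) s +
      (\<Sum>i\<in>{..r + s} - {r}. coeff (wrt j a) i * coeff (wrt j b) (r + s - i))" .
  have "p dvd coeff (wrt j a) i * coeff (wrt j b) (r + s - i)" if "i \<in> {..r + s} - {r}" for i
  proof (cases "i < r")
    case True
    then show ?thesis using less_r by simp
  next
    case False
    then have "r + s - i < s" using that by auto
    then show ?thesis using less_s by simp
  qed
  then have "p dvd (\<Sum>i\<in>{..r + s} - {r}. coeff (wrt j a) i * coeff (wrt j b) (r + s - i))"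
    by (rule dvd_sum)
  moreover have "p dvd coeff (wrt j (a * b)) (r + s)"
    using ab(3) coeffs by blast
  ultimately have "p dvd coeff (wrt j a) r * coeff (wrt j b) s"
    unfolding eq by (simp add: dvd_add_left_iff)
  then show False
    using assms(1) r s lc ab(1,2) unfolding prime_in_def by blast
qed

section \<open>Gauss's lemma: adjoining one variable\<close>

context
  fixes I :: "'n::finite set" and j :: 'n
  assumes j: "j \<notin> I"
    and prime_I: "\<And>\<pi> :: ('n, 'k::field) mpoly. irreducible \<pi> \<Longrightarrow> \<pi> \<in> polys_in I \<Longrightarrow> prime_in I \<pi>"
begin

text \<open>Splits off one prime from a content \<open>c\<close>. The total degree drops for the
  inductions below, and the prime stays prime when \<open>x_j\<close> is adjoined.\<close>

lemma irreducible_factor_in: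
  fixes c :: "('n, 'k) mpoly"
  assumes "c \<in> polys_in I" "c \<noteq> 0" "\<not> c dvd 1"
  obtains \<pi> c' where "c = \<pi> * c'" "irreducible \<pi>" "\<pi> \<in> polys_in I" "c' \<in> polys_in I" "c' \<noteq> 0"
    "tdeg c' < tdeg c" "\<pi> \<noteq> 0" "prime_in (insert j I) \<pi>"
proof -
  obtain \<pi> where \<pi>: "irreducible \<pi>" "\<pi> dvd c"
    using exists_irreducible_factor assms by blast
  then obtain c' where c: "c = \<pi> * c'" by (auto elim: dvdE)
  with assms have nz: "\<pi> \<noteq> 0" "c' \<noteq> 0" by auto
  have "\<pi> \<in> polys_in I" "c' \<in> polys_in I"
    using assms c polys_in_factor[of \<pi> c' I] by auto
  moreover have "tdeg c' < tdeg c"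
    using tdeg_mult[OF nz] unit_iff_tdeg[OF nz(1)] \<pi>(1) unfolding c by (auto simp: irreducible_def)
  ultimately show ?thesis
    using that c \<pi> nz prime_I prime_in_insert[OF prime_I _ j] by blast
qed

text \<open>Each prime factor of \<open>c\<close> divides \<open>q\<close> or \<open>g\<close>.
  Those in \<open>q\<close> cancel, those in \<open>g\<close> are gathered in \<open>c1\<close>, and
  what remains of \<open>g\<close> divides \<open>p\<close> itself.\<close>

lemma split_common_content:
  fixes c p q g :: "('n, 'k) mpoly"
  assumes "c \<in> polys_in I" "c \<noteq> 0" "c * p = q * g"
    "q \<in> polys_in (insert j I)" "g \<in> polys_in (insert j I)"
  shows "\<exists>c1 g' q'. c1 \<in> polys_in I \<and> c1 \<noteq> 0 \<and> g = c1 * g' \<and> p = q' * g'"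
  using assms
proof (induction "tdeg c" arbitrary: c q g rule: less_induct)
  case less
  show ?case
  proof (cases "c dvd 1")
    case True
    then obtain u where u: "1 = c * u" by (auto elim: dvdE)
    have "u * (c * p) = (u * q) * g" using less.prems(3) by (simp add: ac_simps)
    moreover have "u * (c * p) = p" using u by (metis mult.assoc mult.commute mult_1)
    ultimately show ?thesis by (intro exI[of _ 1] exI[of _ g] exI[of _ "u * q"]) auto
  next
    case False
    obtain \<pi> c' where c: "c = \<pi> * c'" "\<pi> \<in> polys_in I" "c' \<in> polys_in I" "c' \<noteq> 0"
      "tdeg c' < tdeg c" "\<pi> \<noteq> 0" "prime_in (insert j I) \<pi>"
      by (rule irreducible_factor_in[OF less.prems(1,2) False])
    have "\<pi> dvd q * g" using less.prems(3) c(1) by (metis dvd_triv_left mult.assoc)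
    then consider "\<pi> dvd q" | "\<pi> dvd g"
      using c(7) less.prems(4,5) by (auto simp: prime_in_def)
    then show ?thesis
    proof cases
      case 1
      then obtain q0 where q0: "q = \<pi> * q0" by (auto elim: dvdE)
      have eq: "c' * p = q0 * g"
        by (rule mpoly_mult_left_cancel[OF _ c(6)]) (use less.prems(3) c(1) q0 in \<open>simp add: ac_simps\<close>)
      have "q0 \<in> polys_in (insert j I)"
        using less.prems(4) q0 polys_in_factor[of \<pi> q0] c(6) by (cases "q0 = 0") auto
      then show ?thesis using less.hyps[OF c(5,3,4) eq] less.prems(5) by blast
    next
      case 2
      then obtain g0 where g0: "g = \<pi> * g0" by (auto elim: dvdE)
      have eq: "c' * p = q * g0"
        by (rule mpoly_mult_left_cancel[OF _ c(6)]) (use less.prems(3) c(1) g0 in \<open>simp add: ac_simps\<close>)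
      have "g0 \<in> polys_in (insert j I)"
        using less.prems(5) g0 polys_in_factor[of \<pi> g0] c(6) by (cases "g0 = 0") auto
      then obtain c1 g' q' where "c1 \<in> polys_in I" "c1 \<noteq> 0" "g0 = c1 * g'" "p = q' * g'"
        using less.hyps[OF c(5,3,4) eq less.prems(4)] by blast
      then show ?thesis
        using g0 c(2,6) by (intro exI[of _ "\<pi> * c1"] exI[of _ g'] exI[of _ q']) (auto intro: polys_in_mult)
    qed
  qed
qed

text \<open>A prime factor of \<open>c\<close> cannot divide \<open>p\<close>: by irreducibility it
  would be associated to \<open>p\<close>, which involves \<open>x_j\<close>. So it divides the
  cofactor of \<open>p\<close> and cancels.\<close>

lemma dvd_cancel_content:
  fixes c p x :: "('n, 'k) mpoly"
  assumes p: "irreducible p" "deg_wrt j p > 0" "p \<in> polys_in (insert j I)"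
    and "c \<in> polys_in I" "c \<noteq> 0" "p dvd c * x" "x \<in> polys_in (insert j I)"
  shows "p dvd x"
  using assms(4-)
proof (induction "tdeg c" arbitrary: c rule: less_induct)
  case less
  show ?case
  proof (cases "c dvd 1")
    case True
    then obtain u where u: "1 = c * u" by (auto elim: dvdE)
    have "p dvd u * (c * x)" using less.prems(3) by simp
    also have "u * (c * x) = x" using u by (metis mult.assoc mult.commute mult_1)
    finally show ?thesis .
  next
    case False
    obtain \<pi> c' where c: "c = \<pi> * c'" "\<pi> \<in> polys_in I" "c' \<in> polys_in I" "c' \<noteq> 0"
      "tdeg c' < tdeg c" "\<pi> \<noteq> 0" "prime_in (insert j I) \<pi>" "irreducible \<pi>"
      by (rule irreducible_factor_in[OF less.prems(1,2) False])
    obtain y where y: "c * x = p * y" using less.prems(3) by (auto elim: dvdE)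
    have yA: "y \<in> polys_in (insert j I)"
    proof (cases "y = 0")
      case False
      have "c * x \<in> polys_in (insert j I)"
        using less.prems polys_in_mono[of c I "insert j I"] by (intro polys_in_mult) auto
      moreover have "p \<noteq> 0" using p by auto
      ultimately show ?thesis using polys_in_factor[of p y] y False by simp
    qed simp
    have "\<pi> dvd p * y" using y c(1) by (metis dvd_triv_left mult.assoc)
    then consider "\<pi> dvd p" | "\<pi> dvd y"
      using c(7) p(3) yA by (auto simp: prime_in_def)
    then show ?thesis
    proof cases
      case 1
      then obtain u where u: "p = \<pi> * u" by (auto elim: dvdE)
      then have "u dvd 1" using p(1) c(8) by (auto simp: irreducible_def)
      moreover have "u \<noteq> 0" using u p by auto
      ultimately have "u \<in> polys_in I"
        using unit_iff_tdeg tdeg_eq_0D by (metis polys_in_Const)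
      then have "p \<in> polys_in I" using u c(2) polys_in_mult by blast
      then have "deg_wrt j p = 0" using j by (simp add: polys_in_iff_deg_wrt)
      then show ?thesis using p(2) by simp
    next
      case 2
      then obtain z where z: "y = \<pi> * z" by (auto elim: dvdE)
      have "c' * x = p * z"
        by (rule mpoly_mult_left_cancel[OF _ c(6)]) (use y c(1) z in \<open>simp add: ac_simps\<close>)
      then have "p dvd c' * x" by simp
      then show ?thesis using less.hyps[OF c(5,3,4)] less.prems(4) by blast
    qed
  qed
qed

text \<open>Gauss's lemma. For fixed \<open>b\<close> with \<open>p\<close> not dividing \<open>b\<close>, the set \<open>J\<close> of all \<open>g\<close> such that
  \<open>p\<close> divides \<open>g b\<close> contains \<open>p\<close>; an element of least degree in \<open>J\<close> must be associated to \<open>p\<close>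
  up to content, so pseudo-division by \<open>p\<close> shows that \<open>J\<close> is generated by \<open>p\<close>.\<close>

lemma irreducible_prime_in_insert:
  fixes p :: "('n, 'k) mpoly"
  assumes p: "irreducible p" "p \<in> polys_in (insert j I)"
  shows "prime_in (insert j I) p"
proof (cases "deg_wrt j p = 0")
  case True
  then have "p \<in> polys_in I"
    using p(2) by (metis insertE polys_in_iff_deg_wrt)
  then show ?thesis using prime_in_insert[OF prime_I] p j by blast
next
  case False
  let ?A = "polys_in (insert j I) :: ('n, 'k) mpoly set"
  have pos: "deg_wrt j p > 0" and pnz: "p \<noteq> 0" using False by auto
  have sub: "x \<in> ?A" if "x \<in> polys_in I" for x
    using that polys_in_mono by blast
  show ?thesis
    unfolding prime_in_def
  proof (intro ballI impI)
    fix a b assume a: "a \<in> ?A" and b: "b \<in> ?A" and ab: "p dvd a * b"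
    show "p dvd a \<or> p dvd b"
    proof (rule disjCI)
      assume nb: "\<not> p dvd b"
      define J where "J = {g \<in> ?A. g \<noteq> 0 \<and> p dvd g * b}"
      have "p \<in> J" using p pnz by (simp add: J_def)
      then obtain g where g: "g \<in> J" "\<And>x. x \<in> J \<Longrightarrow> deg_wrt j g \<le> deg_wrt j x"
        using ex_has_least_nat[of "\<lambda>x. x \<in> J" p "deg_wrt j"] by blast
      \<comment> \<open>A nonzero remainder would be an element of \<open>J\<close> of too small
        degree. This serves twice, for dividing \<open>p\<close> by \<open>g\<close> and
        \<open>a\<close> by \<open>p\<close>.\<close>
      have rem: "r = 0" if "c * f = q * g' + r" "r = 0 \<or> deg_wrt j r < deg_wrt j g'" "r \<in> ?A"
        "p dvd f * b" "p dvd g' * b" "deg_wrt j g' \<le> deg_wrt j g" for c f q g' r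
      proof (rule ccontr)
        assume "r \<noteq> 0"
        have r: "r = c * f - q * g'" using that(1) by simp
        have "r * b = c * (f * b) - q * (g' * b)" unfolding r by (simp add: algebra_simps)
        then have "p dvd r * b" using that(4,5) by (simp add: dvd_diff)
        then have "r \<in> J" using \<open>r \<noteq> 0\<close> that(3) by (simp add: J_def)
        with g(2) that(2,6) \<open>r \<noteq> 0\<close> show False by fastforce
      qed
      obtain c q r where cqr: "c \<in> polys_in I" "c \<noteq> 0" "q \<in> ?A" "r \<in> ?A" "c * p = q * g + r"
        "r = 0 \<or> deg_wrt j r < deg_wrt j g"
        using pseudo_division[OF j, of g p] g(1) p(2) by (auto simp: J_def)
      have "r = 0" using rem[OF cqr(5,6,4)] g(1) by (simp add: J_def)
      then obtain c1 g' q' where g': "c1 \<in> polys_in I" "c1 \<noteq> 0" "g = c1 * g'" "p = q' * g'"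
        using split_common_content[OF cqr(1,2), of p q g] cqr g(1) by (auto simp: J_def)
      have nz: "q' \<noteq> 0" "g' \<noteq> 0" using g' pnz by auto
      \<comment> \<open>If \<open>g'\<close> were a unit, \<open>p\<close> would divide
        \<open>c1 * b\<close> and, after cancelling the content, \<open>b\<close>.\<close>
      have "\<not> g' dvd 1"
      proof
        assume "g' dvd 1"
        then obtain u where "1 = g' * u" by (auto elim: dvdE)
        have "p dvd u * (g * b)" using g(1) by (simp add: J_def)
        also have "u * (g * b) = (g' * u) * (c1 * b)" using g'(3) by (simp add: ac_simps)
        also have "\<dots> = c1 * b" using \<open>1 = g' * u\<close> by (metis mult_1)
        finally have "p dvd b"
          using dvd_cancel_content[OF p(1) pos p(2) g'(1,2)] b by blast
        then show False using nb by blast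
      qed
      then have "q' dvd 1" using p(1) g'(4) by (auto simp: irreducible_def)
      then obtain u where "q' = Const u" using nz unit_iff_tdeg tdeg_eq_0D by metis
      then have "deg_wrt j q' = 0" using wrt_free[OF polys_in_Const[of u "{}"], of j] by simp
      moreover have "deg_wrt j c1 = 0" using g'(1) j by (simp add: polys_in_iff_deg_wrt)
      \<comment> \<open>So \<open>p\<close> has least degree in \<open>J\<close> as well and can
        take the place of \<open>g\<close> as divisor.\<close>
      ultimately have deg: "deg_wrt j p \<le> deg_wrt j g"
        using g'(2,3,4) nz by (simp add: deg_wrt_mult)
      obtain c2 q2 r2 where cqr2: "c2 \<in> polys_in I" "c2 \<noteq> 0" "q2 \<in> ?A" "r2 \<in> ?A"
        "c2 * a = q2 * p + r2" "r2 = 0 \<or> deg_wrt j r2 < deg_wrt j p"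
        using pseudo_division[OF j pnz a p(2)] by blast
      have "r2 = 0" using rem[OF cqr2(5,6,4) ab _ deg] by simp
      then have "p dvd c2 * a" using cqr2(5) by simp
      then show "p dvd a"
        using dvd_cancel_content[OF p(1) pos p(2) cqr2(1,2)] a by blast
    qed
  qed
qed

end

lemma irreducible_prime_in:
  fixes p :: "('n::finite, 'k::field) mpoly"
  assumes "finite I" "irreducible p" "p \<in> polys_in I"
  shows "prime_in I p"
  using assms
proof (induction I arbitrary: p rule: finite_induct)
  case empty
  then obtain c where c: "p = Const c" using polys_in_empty by blast
  moreover have "p \<noteq> 0" using empty by auto
  ultimately have "p dvd 1" using unit_iff_tdeg tdeg_Const by blast
  with empty show ?case by (auto simp: irreducible_def)
next
  case (insert j I)
  show ?case
    by (rule irreducible_prime_in_insert[OF insert.hyps(2) insert.IH]) (use insert.prems in auto)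
qed

theorem mpoly_irreducible_imp_prime:
  fixes p :: "('n::finite, 'k::field) mpoly"
  assumes "irreducible p" "p dvd a * b"
  shows "p dvd a \<or> p dvd b"
  using irreducible_prime_in[of UNIV p] assms by (auto simp: prime_in_def)

section \<open>Chains of primes containing a self-vanishing system\<close>

text \<open>A nonzero element of least total degree works: \<open>P\<close> contains one of any two
  factors, and by minimality the other has degree zero.\<close>

lemma prime_ideal_irreducible_element:
  fixes P :: "('n::finite, 'k::field) mpoly set"
  assumes P: "prime_ideal P" and "f \<in> P" "f \<noteq> 0"
  shows "\<exists>p\<in>P. irreducible p"
proof -
  have "f \<in> P \<and> f \<noteq> 0" using assms by simp
  then obtain p where p: "p \<in> P" "p \<noteq> 0" "\<And>g. g \<in> P \<Longrightarrow> g \<noteq> 0 \<Longrightarrow> tdeg p \<le> tdeg g"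
    using ex_has_least_nat[of "\<lambda>g. g \<in> P \<and> g \<noteq> 0" f tdeg] by blast
  have "irreducible p"
  proof (rule irreducibleI)
    show "p \<noteq> 0" by fact
    show "\<not> p dvd 1"
    proof
      assume "p dvd 1"
      then obtain k where k: "1 = p * k" by (rule dvdE)
      have "p * k \<in> P" by (rule prime_idealD(5)[OF P p(1)])
      then show False using prime_idealD(2)[OF P] k by simp
    qed
    fix a b assume ab: "p = a * b"
    then have nz: "a \<noteq> 0" "b \<noteq> 0" using p(2) by auto
    have deg: "tdeg p = tdeg a + tdeg b" using tdeg_mult[OF nz] ab by simp
    have "a \<in> P \<or> b \<in> P" using prime_idealD(6)[OF P] p(1) ab by blast
    then have "tdeg a = 0 \<or> tdeg b = 0"
      using p(3)[of a] p(3)[of b] nz deg by linarith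
    then show "a dvd 1 \<or> b dvd 1" using nz unit_iff_tdeg by blast
  qed
  with p(1) show ?thesis by blast
qed

lemma prime_ideal_principal:
  fixes p :: "('n::finite, 'k::field) mpoly"
  assumes "irreducible p"
  shows "prime_ideal {f. p dvd f}"
  using assms mpoly_irreducible_imp_prime[OF assms] by (auto simp: prime_ideal_def irreducible_def)

lemma prime_ideal_zero: "prime_ideal {0 :: ('n::finite, 'k::field) mpoly}"
  by (auto simp: prime_ideal_def)

lemma prime_chain_over_reduced_system:
  fixes h :: "'n::finite \<Rightarrow> ('n, 'k::field) mpoly"
  assumes red: "reduced_system h" and nz: "h i \<noteq> 0"
    and Ps: "length Ps = Suc d" "sorted_wrt (\<subset>) Ps" "\<forall>P\<in>set Ps. prime_ideal P \<and> range h \<subseteq> P"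
  shows "d + 2 \<le> CARD('n)"
proof -
  have P0: "prime_ideal (Ps ! 0)" "range h \<subseteq> Ps ! 0"
    using Ps by (auto simp: nth_mem)
  then obtain p where p: "p \<in> Ps ! 0" "irreducible p"
    using prime_ideal_irreducible_element[of "Ps ! 0" "h i"] nz by blast
  \<comment> \<open>Two primes go in front of \<open>Ps\<close>, which shifts the indices by two and
    gives \<open>d + 2\<close> strict inclusions.\<close>
  define Q where "Q k = (if k = 0 then {0} else if k = 1 then {f. p dvd f} else Ps ! (k - 2))" for k
  have "p \<noteq> 0" using p by auto
  show ?thesis
  proof (rule prime_chain_length_le[of _ Q])
    fix k assume "k \<le> d + 2"
    then show "prime_ideal (Q k)"
      using Ps p(2) prime_ideal_principal prime_ideal_zero by (auto simp: Q_def)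
  next
    fix k assume k: "k < d + 2"
    consider "k = 0" | "k = 1" | "k \<ge> 2" by linarith
    then show "Q k \<subset> Q (Suc k)"
    proof cases
      case 1
      have "p \<in> {f. p dvd f}" "p \<notin> {0}" using \<open>p \<noteq> 0\<close> by simp_all
      then have "{0} \<noteq> {f. p dvd f}" by metis
      then have "{0} \<subset> {f. p dvd f}" by (intro psubsetI) simp_all
      then show ?thesis by (simp only: 1 Q_def) simp
    next
      case 2
      have "{f. p dvd f} \<subseteq> Ps ! 0"
        using prime_idealD(5)[OF P0(1) p(1)] by (auto elim!: dvdE)
      moreover have "{f. p dvd f} \<noteq> Ps ! 0"
      proof
        assume "{f. p dvd f} = Ps ! 0"
        then have "\<forall>a\<in>range h. p dvd a" using P0(2) by blast
        then have "p dvd 1" using red by (auto simp: reduced_system_def is_GCD_def)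
        then show False using p(2) by (simp add: irreducible_def)
      qed
      ultimately have "{f. p dvd f} \<subset> Ps ! 0" by (rule psubsetI)
      then show ?thesis by (simp only: 2 Q_def) simp
    next
      case 3
      then have "Ps ! (k - 2) \<subset> Ps ! (Suc k - 2)"
        using Ps(1,2) k by (intro sorted_wrt_nth_less[of "(\<subset>)"]) auto
      then show ?thesis using 3 by (simp add: Q_def)
    qed
  qed
qed

lemma vanishing_ideal_chain:
  fixes h :: "'n::finite \<Rightarrow> ('n, 'k::field_char_0) mpoly"
  assumes hom: "\<And>i. homogeneous e (h i)"
    and Zs: "length Zs = Suc d" "sorted_wrt (\<subset>) Zs"
      "\<forall>Z\<in>set Zs. proj_closed Z \<and> proj_irreducible Z \<and> Z \<subseteq> fundamental_locus h"
  shows "\<exists>Ps. length Ps = Suc (Suc d) \<and> sorted_wrt (\<subset>) Ps \<and>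
    (\<forall>P\<in>set Ps. prime_ideal P \<and> range h \<subseteq> P)"
proof -
  have space: "Z \<subseteq> proj_space" if "Z \<in> set Zs" for Z
    using Zs(3) that by (auto simp: fundamental_locus_def proj_zeros_def)
  have ne: "Z \<noteq> {}" if "Z \<in> set Zs" for Z
    using Zs(3) that by (auto simp: proj_irreducible_def)
  have h: "range h \<subseteq> vanishing_ideal Z" if "Z \<in> set Zs" for Z
    using Zs(3) that hom by (force simp: vanishing_ideal_def fundamental_locus_def proj_zeros_def)
  have irr: "vanishing_ideal Z \<subset> irrelevant_ideal" if "Z \<in> set Zs" for Z
    using vanishing_ideal_psubset_irrelevant_ideal ne[OF that] space[OF that] .
  define Ps where "Ps = map vanishing_ideal (rev Zs) @ [irrelevant_ideal]"
  have "sorted_wrt (\<lambda>Z Z'. vanishing_ideal Z' \<subset> vanishing_ideal Z) Zs"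
    using Zs(3) by (intro sorted_wrt_mono_rel[OF _ Zs(2)] vanishing_ideal_psubset) auto
  then have "sorted_wrt (\<subset>) Ps"
    using irr by (simp add: Ps_def sorted_wrt_append sorted_wrt_map sorted_wrt_rev)
  moreover have "\<forall>P\<in>set Ps. prime_ideal P \<and> range h \<subseteq> P"
  proof
    fix P assume "P \<in> set Ps"
    then consider Z where "Z \<in> set Zs" "P = vanishing_ideal Z" | "P = irrelevant_ideal"
      by (auto simp: Ps_def)
    then show "prime_ideal P \<and> range h \<subseteq> P"
    proof cases
      case 1
      then show ?thesis
        using prime_ideal_vanishing_ideal[of Z] Zs(3) space h by blast
    next
      case 2
      \<comment> \<open>The chain is nonempty, and any member of it shows that the
        \<open>h j\<close> vanish at the origin.\<close>
      have "hd Zs \<in> set Zs" using Zs(1) by (cases Zs) auto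
      then show ?thesis
        using 2 h irr prime_ideal_irrelevant_ideal by blast
    qed
  qed
  ultimately show ?thesis
    using Zs(1) by (intro exI[of _ Ps]) (simp add: Ps_def)
qed

section \<open>The image and the fundamental locus\<close>

lemma image_locus_subset_fundamental_locus:
  fixes h :: "'n::finite \<Rightarrow> ('n, 'k::field_char_0) mpoly"
  assumes "homogeneous_self_vanishing_system h" "\<And>i. homogeneous d (h i)" "d > 0"
  shows "image_locus h \<subseteq> fundamental_locus h"
proof -
  have "field_deriv h (h j) = 0" for j
    using assms(1) by (simp add: homogeneous_self_vanishing_system_def field_deriv_def)
  then have "mpoly_subst h (h j) = 0" for j
    using subst_self_vanishing[of h d j] assms(2,3) by blast
  then show ?thesis
    by (auto simp: image_locus_def fundamental_locus_def proj_zeros_def)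
qed

text \<open>If the \<open>h j\<close> are constants \<open>a j\<close>, the linear forms
  \<open>a i0 * y_j - a j * y_i0\<close> lie in the kernel, so every point is proportional to
  \<open>a\<close>.\<close>

lemma image_locus_constant:
  fixes h :: "'n::finite \<Rightarrow> ('n, 'k::field) mpoly"
  assumes const: "\<And>i. homogeneous 0 (h i)" and nz: "h i0 \<noteq> 0"
    and pq: "p \<in> image_locus h" "q \<in> image_locus h"
  shows "p = q"
proof -
  have "\<exists>a. h i = Const a" for i
  proof -
    have "h i \<in> polys_in {}" using const[of i] by (auto simp: homogeneous_def polys_in_def)
    then show ?thesis using polys_in_empty by blast
  qed
  then obtain a where a: "h i = Const (a i)" for i by metis
  have "a i0 \<noteq> 0" using nz a[of i0] by auto
  have space: "r \<in> proj_space" if "r \<in> image_locus h" for r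
    using that by (simp add: image_locus_def proj_zeros_def)
  have scaled: "v = (\<lambda>j. v i0 / a i0 * a j)" if "r \<in> image_locus h" "v \<in> r" for r v
  proof
    fix j
    let ?f = "Const (a i0) * Var j - Const (a j) * Var i0"
    have "?f = Poly_Mapping.single (Poly_Mapping.single j 1) (a i0) - Poly_Mapping.single (Poly_Mapping.single i0 1) (a j)"
      by (simp add: Var_def mult_single)
    then have "homogeneous 1 ?f"
      by (auto simp: homogeneous_def in_keys_iff lookup_minus lookup_single when_def split: if_splits)
    moreover have "mpoly_subst h (?f + Const (a j) * Var i0) = mpoly_subst h (Const (a i0) * Var j)"
      by simp
    then have "mpoly_subst h ?f = 0"
      unfolding mpoly_subst_add mpoly_subst_mult mpoly_subst_Const mpoly_subst_Var a
      by (simp add: mult_single mult.commute)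
    ultimately have "mpoly_eval v ?f = 0"
      using that by (auto simp: image_locus_def proj_zeros_def)
    then have "a i0 * v j = a j * v i0"
      by (simp add: mpoly_eval_diff mpoly_eval_mult mpoly_eval_Const mpoly_eval_Var)
    then show "v j = v i0 / a i0 * a j"
      using \<open>a i0 \<noteq> 0\<close> by (simp add: field_simps)
  qed
  obtain v w where v: "v \<in> p" and w: "w \<in> q"
    using proj_space_nonempty space pq by meson
  have "v i0 \<noteq> 0"
    using scaled[OF pq(1) v] proj_space_nonzero[OF space[OF pq(1)] v] by auto
  have "w i0 \<noteq> 0"
    using scaled[OF pq(2) w] proj_space_nonzero[OF space[OF pq(2)] w] by auto
  have "w = (\<lambda>j. w i0 / v i0 * v j)"
  proof
    fix j
    have "v j = v i0 / a i0 * a j" "w j = w i0 / a i0 * a j"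
      using scaled pq v w by meson+
    then show "w j = w i0 / v i0 * v j"
      using \<open>v i0 \<noteq> 0\<close> by simp
  qed
  moreover have "(\<lambda>j. w i0 / v i0 * v j) \<in> p"
    using proj_space_scale[OF space[OF pq(1)] v, of "w i0 / v i0"] \<open>v i0 \<noteq> 0\<close> \<open>w i0 \<noteq> 0\<close> by simp
  ultimately show ?thesis
    using proj_space_eqI space pq w by metis
qed

theorem proposition6p2:
  fixes h :: "'n::finite \<Rightarrow> ('n, 'k::{alg_closed_field, field_char_0}) mpoly"
  assumes "CARD('n) \<ge> 4"
    and "homogeneous_self_vanishing_system h"
    and "reduced_system h"
    and "proj_dim (image_locus h) \<ge> 1"
  shows "(2 \<le> krull_dim (system_quotient h) \<and>
          krull_dim (system_quotient h) \<le> ereal (real CARD('n) - 2)) \<and>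
         (1 \<le> proj_dim (fundamental_locus h) \<and>
          proj_dim (fundamental_locus h) \<le> ereal (real CARD('n) - 3))"
proof -
  obtain i e where h: "h i \<noteq> 0" "\<And>j. homogeneous e (h j)"
    using assms(2) by (auto simp: homogeneous_self_vanishing_system_def)
  \<comment> \<open>If every chain had \<open>d = 0\<close>, the supremum would be at most
    0.\<close>
  obtain d Zs where Zs: "d \<ge> 1" "length Zs = Suc d" "sorted_wrt (\<subset>) Zs"
    "\<forall>Z\<in>set Zs. proj_closed Z \<and> proj_irreducible Z \<and> Z \<subseteq> image_locus h"
  proof (rule ccontr)
    assume "\<not> thesis"
    with that have le: "proj_dim (image_locus h) \<le> 0"
      unfolding proj_dim_def by (intro Sup_least) (fastforce simp: not_less_eq_eq)
    show False using order.trans[OF assms(4) le] by simp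
  qed
  have "e > 0"
  proof (rule ccontr)
    assume "\<not> e > 0"
    then have single: "p = q" if "p \<in> image_locus h" "q \<in> image_locus h" for p q
      using image_locus_constant[of h i] h that by blast
    \<comment> \<open>A nonempty set strictly inside another one requires two points.\<close>
    have "Zs ! 0 \<subset> Zs ! 1"
      using Zs by (intro sorted_wrt_nth_less[of "(\<subset>)"]) auto
    moreover have "Zs ! 0 \<in> set Zs" "Zs ! 1 \<in> set Zs"
      using Zs(1,2) by auto
    then have "Zs ! 0 \<noteq> {}" "Zs ! 1 \<subseteq> image_locus h"
      using Zs(4) by (auto simp: proj_irreducible_def)
    ultimately show False using single by blast
  qed
  then have Zs_T: "\<forall>Z\<in>set Zs. proj_closed Z \<and> proj_irreducible Z \<and> Z \<subseteq> fundamental_locus h"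
    using image_locus_subset_fundamental_locus[OF assms(2) h(2)] Zs(4) by blast
  have "ereal (real (Suc d)) \<le> krull_dim (system_quotient h)"
    unfolding krull_dim_system_quotient
    using vanishing_ideal_chain[OF h(2) Zs(2,3) Zs_T] by (intro Sup_upper) blast
  moreover have "2 \<le> ereal (real (Suc d))" using Zs(1) by simp
  ultimately have 1: "2 \<le> krull_dim (system_quotient h)" by (rule order.trans[rotated])
  have 2: "krull_dim (system_quotient h) \<le> ereal (real CARD('n) - 2)"
    unfolding krull_dim_system_quotient
  proof (intro Sup_least, clarify)
    fix d Ps assume Ps: "length Ps = Suc d" "sorted_wrt (\<subset>) Ps"
      "\<forall>P\<in>set Ps. prime_ideal P \<and> range h \<subseteq> P"
    from prime_chain_over_reduced_system[OF assms(3) h(1) Ps]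
    show "ereal (real d) \<le> ereal (real CARD('n) - 2)" by simp
  qed
  have "ereal (real d) \<le> proj_dim (fundamental_locus h)"
    unfolding proj_dim_def using Zs(2,3) Zs_T by (intro Sup_upper) blast
  moreover have "1 \<le> ereal (real d)" using Zs(1) by simp
  ultimately have 3: "1 \<le> proj_dim (fundamental_locus h)" by (rule order.trans[rotated])
  have 4: "proj_dim (fundamental_locus h) \<le> ereal (real CARD('n) - 3)"
    unfolding proj_dim_def
  proof (intro Sup_least, clarify)
    fix d Zs assume Zs: "length Zs = Suc d" "sorted_wrt (\<subset>) Zs"
      "\<forall>Z\<in>set Zs. proj_closed Z \<and> proj_irreducible Z \<and> Z \<subseteq> fundamental_locus h"
    obtain Ps where "length Ps = Suc (Suc d)" "sorted_wrt (\<subset>) Ps"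
      "\<forall>P\<in>set Ps. prime_ideal P \<and> range h \<subseteq> P"
      using vanishing_ideal_chain[OF h(2) Zs] by blast
    \<comment> \<open>The chain of primes is longer by one than \<open>Zs\<close>, so
      \<open>(d + 1) + 2 \<le> n\<close>.\<close>
    from prime_chain_over_reduced_system[OF assms(3) h(1) this]
    show "ereal (real d) \<le> ereal (real CARD('n) - 3)" by simp
  qed
  show ?thesis using 1 2 3 4 by blast
qed

end
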